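(* For every $\varepsilon>0$ there exists $k_0$ such that for every integer $k\ge k_0$ and every $\Delta \le (1-\varepsilon)k\ln k$ the following holds. Let $G$ be a finite triangle-free graph of maximum degree at most $\Delta$ and let $\boldsymbol{\sigma}$ be a uniformly random proper $k$-colouring of $G$. Then for every vertex $v \in V(G)$, with probability at least $1-\mathrm{e}^{-\Delta^{\varepsilon/3}}$ both of the following hold: (1) in $\boldsymbol{\sigma}$, $v$ is $(\Delta+1)$-loose; (2) in $\boldsymbol{\sigma}$, $v$ is thawed (i.e. $1$-thawed).
   Context: For proper $k$-colourings $\sigma,\tau$ of $G$ let $\mathrm{dist}(\tau,\sigma)\coloneqq\#\{v: \sigma(v)\ne\tau(v)\}$ (Hamming distance). For $t\in\mathbb{N}$, the distance-$t$ $k$-colouring graph $\mathcal{H}(G,k,t)$ has as vertices the proper $k$-colourings of $G$, two distinct colourings $\tau,\sigma$ being adjacent if $\mathrm{dist}(\tau,\sigma)\le t$; its connected components are called $t$-clusters. Given a proper $k$-colouring $\tau$ and a vertex $v$: $v$ is $t$-loose in $\tau$ if for every $j\in[k]$ there exists a neighbour $\sigma$ of $\tau$ in $\mathcal{H}(G,k,t)$ with $\sigma(v)=j$; $v$ is $t$-thawed in $\tau$ if for every $j\in[k]$ there exists $\sigma$ in the same $t$-cluster as $\tau$ with $\sigma(v)=j$. "Thawed" means $1$-thawed.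
   Formalization: In "t-loose", for the colour j that v already has, the colouring itself is accepted as the witness instead of a distinct neighbour; read literally, the claim fails for the one-vertex graph with Δ ≥ 1. *)

theory Defs
  imports "HOL-Probability.Probability" "Graph_Theory.Graph_Theory"
begin

text \<open>
  Finite simple graphs are values \<open>G\<close> with \<^term>\<open>pair_graph G\<close>: an edge \<open>uv\<close> is the
  pair of arcs \<open>(u, v)\<close> and \<open>(v, u)\<close>, so the degree of a vertex is its out-degree.
\<close>

definition triangle_free :: "'v pair_pre_digraph \<Rightarrow> bool" where
  "triangle_free G \<longleftrightarrow>
     \<not> (\<exists>u v w. (u, v) \<in> parcs G \<and> (v, w) \<in> parcs G \<and> (w, u) \<in> parcs G)"

text \<open>
  Colourings are extensional functions on the vertex set, so that distinct functions are
  distinct colourings and the set of colourings is finite.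
\<close>

definition proper_colourings :: "'v pair_pre_digraph \<Rightarrow> nat \<Rightarrow> ('v \<Rightarrow> nat) set" where
  "proper_colourings G k =
     {\<sigma> \<in> pverts G \<rightarrow>\<^sub>E {1..k}. \<forall>(u, v) \<in> parcs G. \<sigma> u \<noteq> \<sigma> v}"

definition hamming_dist :: "'v pair_pre_digraph \<Rightarrow> ('v \<Rightarrow> nat) \<Rightarrow> ('v \<Rightarrow> nat) \<Rightarrow> nat" where
  "hamming_dist G \<tau> \<sigma> = card {v \<in> pverts G. \<sigma> v \<noteq> \<tau> v}"

definition colouring_graph ::
  "'v pair_pre_digraph \<Rightarrow> nat \<Rightarrow> nat \<Rightarrow> ('v \<Rightarrow> nat) pair_pre_digraph" where
  "colouring_graph G k t =
     \<lparr> pverts = proper_colourings G k,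
       parcs = {(\<tau>, \<sigma>). \<tau> \<in> proper_colourings G k \<and> \<sigma> \<in> proper_colourings G k \<and>
                        \<tau> \<noteq> \<sigma> \<and> hamming_dist G \<tau> \<sigma> \<le> t} \<rparr>"

text \<open>
  The arc relation of the colouring graph is symmetric, hence its strongly connected
  components are the connected components of the undirected graph.
\<close>

definition clusters :: "'v pair_pre_digraph \<Rightarrow> nat \<Rightarrow> nat \<Rightarrow> ('v \<Rightarrow> nat) set set" where
  "clusters G k t = pre_digraph.sccs_verts (with_proj (colouring_graph G k t))"

text \<open>
  For the colour \<open>j = \<tau> v\<close>, which \<open>v\<close> already has, \<open>\<tau>\<close> itself is accepted as a witness.
  If a colouring different from \<open>\<tau>\<close> were required there too, then the vertex of the
  one-vertex graph would not be \<open>t\<close>-loose for any \<open>t\<close>.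
\<close>

definition loose ::
  "'v pair_pre_digraph \<Rightarrow> nat \<Rightarrow> nat \<Rightarrow> ('v \<Rightarrow> nat) \<Rightarrow> 'v \<Rightarrow> bool" where
  "loose G k t \<tau> v \<longleftrightarrow>
     (\<forall>j \<in> {1..k}. \<exists>\<sigma>. (\<sigma> = \<tau> \<or> (\<tau>, \<sigma>) \<in> parcs (colouring_graph G k t)) \<and> \<sigma> v = j)"

definition thawed ::
  "'v pair_pre_digraph \<Rightarrow> nat \<Rightarrow> nat \<Rightarrow> ('v \<Rightarrow> nat) \<Rightarrow> 'v \<Rightarrow> bool" where
  "thawed G k t \<tau> v \<longleftrightarrow>
     (\<forall>j \<in> {1..k}. \<exists>C \<in> clusters G k t. \<exists>\<sigma>. \<tau> \<in> C \<and> \<sigma> \<in> C \<and> \<sigma> v = j)"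

end

theory Submission
  imports Defs "HOL-Real_Asymp.Real_Asymp"
begin

text \<open>
  If every neighbour of \<open>v\<close> has two colours available, then the neighbours coloured \<open>j\<close>, which
  form an independent set, can be recoloured one by one, and then \<open>v\<close> can receive \<open>j\<close>. So it
  suffices that a fixed vertex \<open>u\<close> very rarely has fewer than two available colours.

  This follows Rosenfeld's counting method. By induction on the vertex set \<open>X\<close>, for
  \<open>v \<notin> X\<close>, all but a tiny proportion \<open>p\<close> of the proper colourings of \<open>X\<close> leave at
  least \<open>s \<approx> (ln k)\<^sup>2\<close> colours for \<open>v\<close>; hence adding a vertex multiplies the number of colourings
  by at least \<open>s / 2\<close>. In the induction step, call a neighbour of \<open>v\<close> bad if it has at most \<open>t\<close>
  colours available. Deleting a set \<open>I\<close> of bad neighbours shows that all of \<open>I\<close> is bad with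
  probability at most \<open>(2t / s) ^ |I|\<close>, so a linear number of bad neighbours is exponentially
  unlikely. Conditionally on the colours outside the neighbourhood, the neighbours of \<open>v\<close> are
  coloured independently and uniformly from their lists; the events that a colour is used are
  negatively correlated, so the number of unused colours exceeds \<open>s\<close> except with
  probability \<open>2 ^ s * exp (- \<mu> / 2)\<close>, where its mean \<open>\<mu>\<close> is of order at least \<open>k powr (\<epsilon> / 2)\<close>.
\<close>

subsection \<open>Random choices from lists\<close>

text \<open>Chernoff bound with base 2: \<open>2 ^ card (K \<inter> B \<omega>)\<close> counts the sets \<open>S \<subseteq> K \<inter> B \<omega>\<close>.\<close>

lemma card_many_hits_le:
  fixes a :: "'c \<Rightarrow> real"
  assumes fin: "finite \<Omega>" "finite K"
    and le: "\<And>S. S \<subseteq> K \<Longrightarrow> real (card {\<omega>\<in>\<Omega>. S \<subseteq> B \<omega>}) \<le> (\<Prod>c\<in>S. a c) * M"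
  shows "2 ^ r * real (card {\<omega>\<in>\<Omega>. r \<le> card (K \<inter> B \<omega>)}) \<le> (\<Prod>c\<in>K. 1 + a c) * M"
proof -
  have "2 ^ r * real (card {\<omega>\<in>\<Omega>. r \<le> card (K \<inter> B \<omega>)})
      = (\<Sum>\<omega>\<in>{\<omega>\<in>\<Omega>. r \<le> card (K \<inter> B \<omega>)}. 2 ^ r :: real)" by simp
  also have "\<dots> \<le> (\<Sum>\<omega>\<in>{\<omega>\<in>\<Omega>. r \<le> card (K \<inter> B \<omega>)}. 2 ^ card (K \<inter> B \<omega>))"
    by (rule sum_mono) auto
  also have "\<dots> \<le> (\<Sum>\<omega>\<in>\<Omega>. 2 ^ card (K \<inter> B \<omega>))"
    by (rule sum_mono2) (use fin in auto)
  also have "\<dots> = (\<Sum>\<omega>\<in>\<Omega>. \<Sum>S\<in>Pow K. of_bool (S \<subseteq> B \<omega>))"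
  proof (rule sum.cong)
    fix \<omega>
    have "Pow K \<inter> {S. S \<subseteq> B \<omega>} = Pow (K \<inter> B \<omega>)" by auto
    then show "(2::real) ^ card (K \<inter> B \<omega>) = (\<Sum>S\<in>Pow K. of_bool (S \<subseteq> B \<omega>))"
      using fin card_Pow[of "K \<inter> B \<omega>"] by (simp add: of_bool_def sum.If_cases del: Pow_Int_eq)
  qed simp
  also have "\<dots> = (\<Sum>S\<in>Pow K. \<Sum>\<omega>\<in>\<Omega>. of_bool (S \<subseteq> B \<omega>))" by (rule sum.swap)
  also have "\<dots> = (\<Sum>S\<in>Pow K. real (card {\<omega>\<in>\<Omega>. S \<subseteq> B \<omega>}))"
    using fin by (intro sum.cong) (auto simp: of_bool_def sum.If_cases Int_def)
  also have "\<dots> \<le> (\<Sum>S\<in>Pow K. (\<Prod>c\<in>S. a c) * M)" by (rule sum_mono) (use le in auto)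
  also have "\<dots> = (\<Prod>c\<in>K. 1 + a c) * M"
    using prod_add[OF fin(2), of a "\<lambda>_. 1"] by (simp add: sum_distrib_right add.commute)
  finally show ?thesis .
qed

text \<open>The probability that no coordinate of a uniformly random \<open>f \<in> PiE N L\<close> equals \<open>c\<close>.\<close>

definition miss_prob :: "'v set \<Rightarrow> ('v \<Rightarrow> 'c set) \<Rightarrow> 'c \<Rightarrow> real" where
  "miss_prob N L c = (\<Prod>w\<in>N. if c \<in> L w then 1 - 1 / real (card (L w)) else 1)"

lemma miss_prob_bounds:
  assumes "\<And>w. w \<in> N \<Longrightarrow> finite (L w)"
  shows "0 \<le> miss_prob N L c" "miss_prob N L c \<le> 1"
proof -
  have "1 \<le> card (L w)" if "w \<in> N" "c \<in> L w" for w
    using assms that by (metis One_nat_def Suc_leI card_gt_0_iff empty_iff)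
  then have *: "0 \<le> (if c \<in> L w then 1 - 1 / real (card (L w)) else 1)"
      "(if c \<in> L w then 1 - 1 / real (card (L w)) else 1) \<le> 1" if "w \<in> N" for w
    using that by (auto simp: divide_le_eq_1)
  show "0 \<le> miss_prob N L c" "miss_prob N L c \<le> 1"
    unfolding miss_prob_def using * by (auto intro!: prod_nonneg prod_le_1)
qed

text \<open>Changing a value \<open>f w = c\<close> to any other element of \<open>L w\<close> does not uncover a colour of \<open>S\<close>,
  so missing \<open>c\<close> and hitting all of \<open>S\<close> are positively correlated.\<close>

lemma card_hit_and_miss_ge:
  assumes N: "finite N" and L: "\<And>w. w \<in> N \<Longrightarrow> finite (L w)" and c: "c \<notin> S" and A: "A \<subseteq> N"
  shows "miss_prob A L c * card {f \<in> PiE N L. S \<subseteq> f ` N}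
           \<le> card {f \<in> PiE N L. S \<subseteq> f ` N \<and> c \<notin> f ` A}"
  using finite_subset[OF A N] A
proof (induction A)
  case empty
  then show ?case by (simp add: miss_prob_def)
next
  case (insert w A)
  define T where "T = {f \<in> PiE N L. S \<subseteq> f ` N \<and> c \<notin> f ` A}"
  define T1 where "T1 = {f \<in> T. f w = c}"
  define T2 where "T2 = {f \<in> T. f w \<noteq> c}"
  have finT: "finite T" using finite_PiE[OF N L] unfolding T_def by auto
  have T2: "{f \<in> PiE N L. S \<subseteq> f ` N \<and> c \<notin> f ` insert w A} = T2"
    unfolding T2_def T_def by auto
  have IH: "miss_prob A L c * card {f \<in> PiE N L. S \<subseteq> f ` N} \<le> card T"
    using insert unfolding T_def by auto
  have w: "w \<in> N" using insert by auto
  show ?case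
  proof (cases "c \<in> L w")
    case False
    then have "T2 = T" using w unfolding T2_def T_def by auto
    then show ?thesis using IH False insert.hyps unfolding T2
      by (simp add: miss_prob_def)
  next
    case True
    define l where "l = card (L w)"
    have l: "1 \<le> l" using True L[OF w] unfolding l_def
      by (metis One_nat_def Suc_leI card_gt_0_iff empty_iff)
    \<comment> \<open>Replacing the value \<open>c\<close> at \<open>w\<close> by one of the
      \<open>l - 1\<close> others leads into \<open>T2\<close>, injectively because the overwritten
      value is known to be \<open>c\<close>.\<close>
    have "card (T1 \<times> (L w - {c})) \<le> card T2"
    proof (rule card_inj_on_le)
      show "inj_on (\<lambda>(f, x). f(w := x)) (T1 \<times> (L w - {c}))"
      proof (rule inj_onI)
        fix p q assume p: "p \<in> T1 \<times> (L w - {c})" and q: "q \<in> T1 \<times> (L w - {c})"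
          and eq: "(\<lambda>(f, x). f(w := x)) p = (\<lambda>(f, x). f(w := x)) q"
        obtain f x g y where pq: "p = (f, x)" "q = (g, y)" by (metis surj_pair)
        have upd: "f(w := x) = g(w := y)" using eq pq by simp
        have "f = (f(w := x))(w := c)" "g = (g(w := y))(w := c)"
          using p q pq unfolding T1_def by auto
        then have "f = g" using upd by metis
        moreover have "x = y" using fun_cong[OF upd, of w] by simp
        ultimately show "p = q" using pq by simp
      qed
      show "(\<lambda>(f, x). f(w := x)) ` (T1 \<times> (L w - {c})) \<subseteq> T2"
      proof (rule image_subsetI, simp only: mem_Sigma_iff split_paired_all prod.case Diff_iff singleton_iff, elim conjE)
        fix f x assume f: "f \<in> T1" and x: "x \<in> L w" "x \<noteq> c"
        have "f(w := x) \<in> PiE N L"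
          using f x w unfolding T1_def T_def by (auto simp: PiE_iff extensional_def)
        moreover have "S \<subseteq> (f(w := x)) ` N"
        proof
          fix d assume d: "d \<in> S"
          then obtain u where "u \<in> N" "d = f u" using f unfolding T1_def T_def by auto
          \<comment> \<open>\<open>f w = c\<close> and \<open>c \<notin> S\<close>, so
            \<open>w\<close> is not the coordinate that hits \<open>d\<close>, and the change at
            \<open>w\<close> does not lose \<open>d\<close>.\<close>
          moreover from this have "u \<noteq> w" using f d c unfolding T1_def by auto
          ultimately show "d \<in> (f(w := x)) ` N" by (auto intro!: image_eqI[of _ _ u])
        qed
        moreover have "c \<notin> (f(w := x)) ` A"
          using f insert.hyps unfolding T1_def T_def by auto
        ultimately show "f(w := x) \<in> T2" using x unfolding T2_def T_def by auto
      qed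
      show "finite T2" using finT unfolding T2_def by auto
    qed
    then have "card T1 * (l - 1) \<le> card T2"
      using True L[OF w] by (simp add: card_cartesian_product l_def)
    then have "real (card T1) * (real l - 1) \<le> real (card T2)"
      using l by (metis of_nat_1 of_nat_diff of_nat_le_iff of_nat_mult)
    moreover have "card T = card T1 + card T2"
      using finT by (subst card_Un_disjoint[symmetric]) (auto simp: T1_def T2_def intro: arg_cong[where f=card])
    ultimately have "(1 - 1 / real l) * real (card T) \<le> real (card T2)"
      using l by (simp add: field_simps)
    moreover have "(1 - 1 / real l) * (miss_prob A L c * card {f \<in> PiE N L. S \<subseteq> f ` N})
        \<le> (1 - 1 / real l) * real (card T)"
      using IH l by (intro mult_left_mono) auto
    ultimately show ?thesis using True insert.hyps unfolding T2
      by (simp add: miss_prob_def l_def mult.assoc)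
  qed
qed

text \<open>Induction on \<open>S\<close>: by the correlation inequality with \<open>A = N\<close>,
  among the functions hitting \<open>S\<close> a proportion of at least
  \<open>miss_prob N L c\<close> misses the new colour \<open>c\<close>, so earlier hits do not make
  another hit likelier.\<close>

lemma card_all_hit_le:
  assumes N: "finite N" and L: "\<And>w. w \<in> N \<Longrightarrow> finite (L w)" and S: "finite S"
  shows "real (card {f \<in> PiE N L. S \<subseteq> f ` N})
           \<le> (\<Prod>c\<in>S. 1 - miss_prob N L c) * real (card (PiE N L))"
  using S
proof (induction S)
  case empty
  then show ?case by simp
next
  case (insert c S)
  have fin: "finite (PiE N L)" by (rule finite_PiE[OF N L])
  have "{f \<in> PiE N L. S \<subseteq> f ` N} = {f \<in> PiE N L. insert c S \<subseteq> f ` N}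
      \<union> {f \<in> PiE N L. S \<subseteq> f ` N \<and> c \<notin> f ` N}" by auto
  then have "card {f \<in> PiE N L. S \<subseteq> f ` N} = card {f \<in> PiE N L. insert c S \<subseteq> f ` N}
      + card {f \<in> PiE N L. S \<subseteq> f ` N \<and> c \<notin> f ` N}"
    using fin by (subst card_Un_disjoint[symmetric]) auto
  then have "real (card {f \<in> PiE N L. insert c S \<subseteq> f ` N})
      \<le> (1 - miss_prob N L c) * card {f \<in> PiE N L. S \<subseteq> f ` N}"
    using card_hit_and_miss_ge[of N L c S N] N L insert.hyps by (simp add: algebra_simps)
  also have "\<dots> \<le> (1 - miss_prob N L c) * ((\<Prod>c\<in>S. 1 - miss_prob N L c) * real (card (PiE N L)))"
    using insert.IH miss_prob_bounds[of N L] L by (intro mult_left_mono) auto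
  finally show ?case using insert.hyps by (simp add: mult.assoc)
qed

text \<open>Missing fewer than \<open>s\<close> colours means hitting more than
  \<open>card K - s\<close>. For a miss probability \<open>q\<close>, the factor
  \<open>1 + (1 - q) = 2 * (1 - q / 2)\<close> is at most \<open>2 * exp (- q / 2)\<close>, and
  dividing by \<open>2 ^ r\<close> leaves only \<open>2 ^ s\<close> of the powers of 2.\<close>

lemma card_few_missed_le:
  assumes N: "finite N" and L: "\<And>w. w \<in> N \<Longrightarrow> finite (L w)" and K: "finite K"
  shows "real (card {f \<in> PiE N L. card (K - f ` N) < s})
           \<le> 2 ^ s * exp (- (\<Sum>c\<in>K. miss_prob N L c) / 2) * real (card (PiE N L))"
proof -
  define r where "r = card K - s"
  have "2 ^ r * real (card {f \<in> PiE N L. r \<le> card (K \<inter> f ` N)})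
      \<le> (\<Prod>c\<in>K. 1 + (1 - miss_prob N L c)) * real (card (PiE N L))"
    by (rule card_many_hits_le[OF finite_PiE[OF N L] K card_all_hit_le[OF N L finite_subset[OF _ K]]])
  also have "\<dots> \<le> (\<Prod>c\<in>K. 2 * exp (- miss_prob N L c / 2)) * real (card (PiE N L))"
  proof (intro mult_right_mono prod_mono conjI)
    fix c
    show "0 \<le> 1 + (1 - miss_prob N L c)" using miss_prob_bounds(2)[of N L c] L by simp
    show "1 + (1 - miss_prob N L c) \<le> 2 * exp (- miss_prob N L c / 2)"
      using exp_ge_add_one_self[of "- miss_prob N L c / 2"] by simp
  qed simp
  also have "\<dots> = 2 ^ card K * exp (- (\<Sum>c\<in>K. miss_prob N L c) / 2) * real (card (PiE N L))"
    using K by (simp add: prod.distrib exp_sum sum_divide_distrib flip: sum_negf)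
  \<comment> \<open>In general only \<open>card K \<le> r + s\<close> holds, since the subtraction
    in \<open>r\<close> is truncated when \<open>s > card K\<close>.\<close>
  also have "\<dots> \<le> 2 ^ (r + s) * exp (- (\<Sum>c\<in>K. miss_prob N L c) / 2) * real (card (PiE N L))"
    by (intro mult_right_mono power_increasing) (auto simp: r_def)
  finally have *: "2 ^ r * real (card {f \<in> PiE N L. r \<le> card (K \<inter> f ` N)}) \<le>
     2 ^ r * (2 ^ s * exp (- (\<Sum>c\<in>K. miss_prob N L c) / 2) * real (card (PiE N L)))"
    by (simp add: mult.assoc power_add)
  have "{f \<in> PiE N L. card (K - f ` N) < s} \<subseteq> {f \<in> PiE N L. r \<le> card (K \<inter> f ` N)}"
  proof clarsimp
    fix f assume "card (K - f ` N) < s"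
    moreover have "card K = card (K \<inter> f ` N) + card (K - f ` N)"
      using K by (subst card_Un_disjoint[symmetric]) (auto intro: arg_cong[where f=card])
    ultimately show "r \<le> card (K \<inter> f ` N)" unfolding r_def by simp
  qed
  then have "card {f \<in> PiE N L. card (K - f ` N) < s} \<le> card {f \<in> PiE N L. r \<le> card (K \<inter> f ` N)}"
    using finite_PiE[OF N L] by (intro card_mono) auto
  then show ?thesis using * by simp
qed


text \<open>A colour \<open>c\<close> is missed with probability at least
  \<open>exp (- x c)\<close>, where \<open>x c\<close> adds up \<open>1 / (l - 1)\<close> over the
  lists of size \<open>l\<close> containing \<open>c\<close>. Each list contributes at most
  \<open>l / (l - 1) \<le> 1 + 1 / t\<close> to the total of \<open>x\<close> over \<open>K\<close>,
  and convexity of exp turns the bound on the total into the claim.\<close>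

lemma sum_miss_prob_ge:
  assumes N: "finite N" and L: "\<And>w. w \<in> N \<Longrightarrow> finite (L w)" and K: "finite K"
    and large: "\<And>w. w \<in> N \<Longrightarrow> K \<inter> L w \<noteq> {} \<Longrightarrow> t < card (L w)"
    and D: "card N \<le> D" and t: "0 < t" and m: "0 < m" "m \<le> real (card K)"
  shows "m * exp (- (real D * (1 + 1 / real t) / m)) \<le> (\<Sum>c\<in>K. miss_prob N L c)"
proof -
  define x where "x c = (\<Sum>w\<in>N. if c \<in> L w then 1 / (real (card (L w)) - 1) else 0)" for c
  define a where "a = real D * (1 + 1 / real t) / m"
  have a0: "0 \<le> a" using m unfolding a_def by simp
  have miss: "exp (- x c) \<le> miss_prob N L c" if c: "c \<in> K" for c
  proof -
    have "exp (- x c) = (\<Prod>w\<in>N. exp (- (if c \<in> L w then 1 / (real (card (L w)) - 1) else 0)))"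
      unfolding x_def sum_negf[symmetric] by (rule exp_sum[OF N])
    also have "\<dots> \<le> miss_prob N L c"
      unfolding miss_prob_def
    proof (rule prod_mono, rule conjI)
      fix w assume w: "w \<in> N"
      show "exp (- (if c \<in> L w then 1 / (real (card (L w)) - 1) else 0))
          \<le> (if c \<in> L w then 1 - 1 / real (card (L w)) else 1)"
      proof (cases "c \<in> L w")
        case True
        define l where "l = real (card (L w))"
        have "t < card (L w)" using large[OF w] c True by blast
        then have l: "l > 1" using t unfolding l_def by simp
        \<comment> \<open>With \<open>y = 1 / (l - 1)\<close> the factor is exactly
          \<open>1 - 1 / l = 1 / (1 + y)\<close>, so \<open>1 + y \<le> exp y\<close> bounds it from
          below.\<close>
        have "exp (- (1 / (l - 1))) \<le> inverse (1 + 1 / (l - 1))"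
          unfolding exp_minus using l
          by (intro le_imp_inverse_le exp_ge_add_one_self) (simp add: add_pos_nonneg)
        also have "\<dots> = 1 - 1 / l" using l by (simp add: field_simps)
        finally show ?thesis using True by (simp add: l_def)
      qed simp
    qed simp
    finally show ?thesis .
  qed
  have "(\<Sum>c\<in>K. x c) = (\<Sum>w\<in>N. \<Sum>c\<in>K. if c \<in> L w then 1 / (real (card (L w)) - 1) else 0)"
    unfolding x_def by (rule sum.swap)
  also have "\<dots> \<le> (\<Sum>w\<in>N. 1 + 1 / real t)"
  proof (rule sum_mono)
    fix w assume w: "w \<in> N"
    define l where "l = real (card (L w))"
    have eq: "(\<Sum>c\<in>K. if c \<in> L w then 1 / (real (card (L w)) - 1) else 0)
        = real (card (K \<inter> L w)) * (1 / (l - 1))"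
      using K by (simp add: sum.If_cases l_def)
    show "(\<Sum>c\<in>K. if c \<in> L w then 1 / (real (card (L w)) - 1) else 0) \<le> 1 + 1 / real t"
    proof (cases "K \<inter> L w = {}")
      case True
      then show ?thesis unfolding eq by simp
    next
      case False
      then have "t + 1 \<le> card (L w)" using large[OF w] by simp
      then have l: "l \<ge> real t + 1" unfolding l_def by linarith
      have "card (K \<inter> L w) \<le> card (L w)" by (intro card_mono) (use L[OF w] in auto)
      then have "real (card (K \<inter> L w)) \<le> l" unfolding l_def by simp
      then have "real (card (K \<inter> L w)) * (1 / (l - 1)) \<le> l * (1 / (l - 1))"
        using l t by (intro mult_right_mono) auto
      also have "\<dots> = 1 + 1 / (l - 1)" using l t by (simp add: field_simps)
      also have "\<dots> \<le> 1 + 1 / real t" using l t by (simp add: frac_le)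
      finally show ?thesis unfolding eq .
    qed
  qed
  also have "\<dots> \<le> real D * (1 + 1 / real t)"
    using D by (simp add: mult_right_mono add_nonneg_nonneg)
  also have "\<dots> = m * a" using m unfolding a_def by simp
  finally have sum_x: "(\<Sum>c\<in>K. x c) \<le> m * a" .
  \<comment> \<open>Jensen's inequality, via the tangent of exp at \<open>- a\<close>\<close>
  have "m * exp (- a) \<le> (real (card K) + (real (card K) - m) * a) * exp (- a)"
    using m a0 by (intro mult_right_mono add_increasing2 mult_nonneg_nonneg) auto
  also have "\<dots> \<le> (real (card K) + real (card K) * a - (\<Sum>c\<in>K. x c)) * exp (- a)"
    using sum_x by (intro mult_right_mono) (auto simp: algebra_simps)
  also have "\<dots> = (\<Sum>c\<in>K. exp (- a) * (1 + (a - x c)))"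
    unfolding sum_distrib_left[symmetric] by (simp add: sum.distrib sum_subtractf algebra_simps)
  also have "\<dots> \<le> (\<Sum>c\<in>K. exp (- a) * exp (a - x c))"
    by (intro sum_mono mult_left_mono exp_ge_add_one_self) auto
  also have "\<dots> = (\<Sum>c\<in>K. exp (- x c))" by (simp flip: exp_add)
  also have "\<dots> \<le> (\<Sum>c\<in>K. miss_prob N L c)" by (intro sum_mono miss)
  finally show ?thesis unfolding a_def .
qed

text \<open>The colours in lists of size at most \<open>t\<close> are given up, at most
  \<open>t\<close> per short list. Every list meeting the remaining set \<open>K\<close> is then
  long, and missed colours of \<open>K\<close> are also missed colours of \<open>C\<close>.\<close>

lemma card_few_colours_left_le:
  assumes N: "finite N" and C: "finite C" and L: "\<And>w. w \<in> N \<Longrightarrow> L w \<subseteq> C"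
    and D: "card N \<le> D" and t: "0 < t"
    and m: "0 < m" "m \<le> real (card C) - real t * real (card {w\<in>N. card (L w) \<le> t})"
  shows "real (card {f \<in> PiE N L. card (C - f ` N) < s})
    \<le> 2 ^ s * exp (- (m * exp (- (real D * (1 + 1 / real t) / m))) / 2) * real (card (PiE N L))"
proof -
  have finL: "finite (L w)" if "w \<in> N" for w using L[OF that] C finite_subset by blast
  define Z where "Z = (\<Union>w\<in>{w\<in>N. card (L w) \<le> t}. L w)"
  define K where "K = C - Z"
  have K: "finite K" using C unfolding K_def by auto
  have "card Z \<le> (\<Sum>w\<in>{w\<in>N. card (L w) \<le> t}. card (L w))"
    unfolding Z_def using N by (intro card_UN_le) auto
  also have "\<dots> \<le> (\<Sum>w\<in>{w\<in>N. card (L w) \<le> t}. t)" by (intro sum_mono) auto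
  finally have "card Z \<le> t * card {w\<in>N. card (L w) \<le> t}" by (simp add: mult.commute)
  moreover have "card C \<le> card K + card Z"
  proof -
    have "finite Z" using N finL unfolding Z_def by auto
    then show ?thesis using diff_card_le_card_Diff[of Z C] unfolding K_def by linarith
  qed
  ultimately have "real (card C) \<le> real (card K) + real t * real (card {w\<in>N. card (L w) \<le> t})"
    by (simp flip: of_nat_mult of_nat_add)
  then have mK: "m \<le> real (card K)" using m by simp
  have large: "t < card (L w)" if "w \<in> N" "K \<inter> L w \<noteq> {}" for w
    using that unfolding K_def Z_def by force
  have "card {f \<in> PiE N L. card (C - f ` N) < s} \<le> card {f \<in> PiE N L. card (K - f ` N) < s}"
  proof (intro card_mono subsetI)
    fix f assume f: "f \<in> {f \<in> PiE N L. card (C - f ` N) < s}"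
    have "card (K - f ` N) \<le> card (C - f ` N)" using C unfolding K_def by (intro card_mono) auto
    then show "f \<in> {f \<in> PiE N L. card (K - f ` N) < s}" using f by auto
  qed (use finite_PiE[OF N finL] in auto)
  also have "real \<dots> \<le> 2 ^ s * exp (- (\<Sum>c\<in>K. miss_prob N L c) / 2) * real (card (PiE N L))"
    by (rule card_few_missed_le[OF N finL K])
  also have "\<dots> \<le> 2 ^ s * exp (- (m * exp (- (real D * (1 + 1 / real t) / m))) / 2) * real (card (PiE N L))"
    using sum_miss_prob_ge[OF N finL K large D t m(1) mK] by (intro mult_right_mono mult_left_mono) auto
  finally show ?thesis by simp
qed

subsection \<open>Counting colourings of triangle-free graphs\<close>

text \<open>The relation \<open>E\<close> stays fixed while subsets \<open>X\<close> of
  \<open>V\<close> vary, so an induction over induced subgraphs only changes the vertex set.\<close>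

locale triangle_free_graph =
  fixes V :: "'v set" and E :: "('v \<times> 'v) set" and k D :: nat
  assumes finV: "finite V"
    and sym: "(u, w) \<in> E \<Longrightarrow> (w, u) \<in> E"
    and no_loop: "(u, u) \<notin> E"
    and no_triangle: "(u, v) \<in> E \<Longrightarrow> (v, w) \<in> E \<Longrightarrow> (w, u) \<notin> E"
    and degree: "u \<in> V \<Longrightarrow> card {w \<in> V. (u, w) \<in> E} \<le> D"
begin

definition nbrs :: "'v set \<Rightarrow> 'v \<Rightarrow> 'v set" where
  "nbrs X u = {w \<in> X. (u, w) \<in> E}"

definition cols :: "'v set \<Rightarrow> ('v \<Rightarrow> nat) set" where
  "cols X = {\<sigma> \<in> X \<rightarrow>\<^sub>E {1..k}. \<forall>u\<in>X. \<forall>w\<in>X. (u, w) \<in> E \<longrightarrow> \<sigma> u \<noteq> \<sigma> w}"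

text \<open>For \<open>u\<close> outside \<open>X\<close> these are the colours with which a proper
  \<open>\<sigma>\<close> extends to \<open>u\<close>. For \<open>u\<close> in \<open>X\<close> they
  include \<open>\<sigma> u\<close> itself, so two available colours mean at least one genuine
  alternative.\<close>

definition avail :: "'v set \<Rightarrow> ('v \<Rightarrow> nat) \<Rightarrow> 'v \<Rightarrow> nat set" where
  "avail X \<sigma> u = {1..k} - \<sigma> ` nbrs X u"

definition indep :: "'v set \<Rightarrow> bool" where
  "indep I \<longleftrightarrow> (\<forall>u\<in>I. \<forall>w\<in>I. (u, w) \<notin> E)"

definition join :: "'v set \<Rightarrow> ('v \<Rightarrow> nat) \<Rightarrow> ('v \<Rightarrow> nat) \<Rightarrow> 'v \<Rightarrow> nat" where
  "join I \<rho> f = (\<lambda>x. if x \<in> I then f x else \<rho> x)"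

text \<open>Triangle-freeness enters the counting here: an edge between two neighbours of
  \<open>v\<close> would close a triangle.\<close>

lemma indep_nbrs: "indep (nbrs X v)"
  using no_triangle sym unfolding indep_def nbrs_def by blast

lemma indep_single: "indep {v}"
  using no_loop unfolding indep_def by blast

lemma finite_cols: "finite X \<Longrightarrow> finite (cols X)"
  unfolding cols_def using finite_PiE[of X "\<lambda>_. {1..k}"] by auto

lemma finite_avail: "finite (avail X \<sigma> u)"
  unfolding avail_def by auto

lemma avail_join:
  assumes "I \<subseteq> X" "indep I" "w \<in> I"
  shows "avail X (join I \<rho> f) w = avail (X - I) \<rho> w"
proof -
  have "nbrs X w = nbrs (X - I) w" using assms unfolding nbrs_def indep_def by auto
  moreover have "join I \<rho> f ` nbrs (X - I) w = \<rho> ` nbrs (X - I) w"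
    unfolding join_def nbrs_def by (intro image_cong) auto
  ultimately show ?thesis unfolding avail_def by simp
qed

text \<open>No edge lies inside \<open>I\<close>, and the lists already exclude the colours of
  neighbours outside \<open>I\<close>. Hence, conditionally on the colours \<open>\<rho>\<close>
  outside, a uniformly random colouring is uniform on a product of lists over
  \<open>I\<close>.\<close>

lemma bij_betw_join:
  assumes I: "I \<subseteq> X" "indep I"
  shows "bij_betw (\<lambda>(\<rho>, f). join I \<rho> f) (SIGMA \<rho> : cols (X - I). PiE I (avail (X - I) \<rho>)) (cols X)"
proof (rule bij_betwI[where g = "\<lambda>\<sigma>. (restrict \<sigma> (X - I), restrict \<sigma> I)"])
  show "(\<lambda>(\<rho>, f). join I \<rho> f) \<in> (SIGMA \<rho> : cols (X - I). PiE I (avail (X - I) \<rho>)) \<rightarrow> cols X"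
  proof (rule funcsetI, simp only: split_paired_all mem_Sigma_iff prod.case, elim conjE)
    fix \<rho> f assume \<rho>: "\<rho> \<in> cols (X - I)" and f: "f \<in> PiE I (avail (X - I) \<rho>)"
    have "join I \<rho> f \<in> X \<rightarrow>\<^sub>E {1..k}"
      using \<rho> f I unfolding join_def cols_def avail_def by (auto simp: PiE_iff extensional_def)
    moreover have "join I \<rho> f u \<noteq> join I \<rho> f w" if "u \<in> X" "w \<in> X" "(u, w) \<in> E" for u w
    proof -
      have *: "f u \<noteq> \<rho> w" if "u \<in> I" "w \<in> X - I" "(u, w) \<in> E" for u w
      proof -
        have "f u \<in> avail (X - I) \<rho> u" using f that by auto
        then show ?thesis using that unfolding avail_def nbrs_def by auto
      qed
      have "\<rho> u \<noteq> \<rho> w" if "u \<in> X - I" "w \<in> X - I" "(u, w) \<in> E" for u w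
        using \<rho> that unfolding cols_def by auto
      then show ?thesis using that *[of u w] *[of w u] sym I(2) unfolding join_def indep_def
        by (auto split: if_splits)
    qed
    ultimately show "join I \<rho> f \<in> cols X" unfolding cols_def by auto
  qed
  show "(\<lambda>\<sigma>. (restrict \<sigma> (X - I), restrict \<sigma> I)) \<in> cols X \<rightarrow> (SIGMA \<rho> : cols (X - I). PiE I (avail (X - I) \<rho>))"
  proof (rule funcsetI)
    fix \<sigma> assume \<sigma>: "\<sigma> \<in> cols X"
    have "restrict \<sigma> (X - I) \<in> cols (X - I)" using \<sigma> unfolding cols_def by (auto simp: PiE_iff)
    moreover have "restrict \<sigma> I \<in> PiE I (avail (X - I) (restrict \<sigma> (X - I)))"
    proof (rule PiE_I)
      fix x assume x: "x \<in> I"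
      have "\<sigma> x \<in> {1..k}" using \<sigma> x I unfolding cols_def by (auto simp: PiE_iff)
      moreover have "\<sigma> x \<noteq> \<sigma> y" if "y \<in> nbrs (X - I) x" for y
        using \<sigma> that x I unfolding cols_def nbrs_def by auto
      ultimately show "restrict \<sigma> I x \<in> avail (X - I) (restrict \<sigma> (X - I)) x"
        using x unfolding avail_def nbrs_def by auto
    qed auto
    ultimately show "(restrict \<sigma> (X - I), restrict \<sigma> I) \<in> (SIGMA \<rho> : cols (X - I). PiE I (avail (X - I) \<rho>))"
      by blast
  qed
  fix p assume p: "p \<in> (SIGMA \<rho> : cols (X - I). PiE I (avail (X - I) \<rho>))"
  obtain \<rho> f where pq: "p = (\<rho>, f)" by (cases p)
  have ext: "\<rho> \<in> extensional (X - I)" "f \<in> extensional I"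
    using p pq unfolding cols_def by (auto simp: PiE_iff)
  have "restrict (join I \<rho> f) (X - I) = \<rho>" "restrict (join I \<rho> f) I = f"
    using ext unfolding join_def by (auto simp: extensional_def restrict_def fun_eq_iff)
  then show "(restrict (case p of (\<rho>, f) \<Rightarrow> join I \<rho> f) (X - I), restrict (case p of (\<rho>, f) \<Rightarrow> join I \<rho> f) I) = p"
    using pq by simp
next
  fix \<sigma> assume "\<sigma> \<in> cols X"
  then have "\<sigma> \<in> extensional X" unfolding cols_def by (auto simp: PiE_iff)
  then show "(case (restrict \<sigma> (X - I), restrict \<sigma> I) of (\<rho>, f) \<Rightarrow> join I \<rho> f) = \<sigma>"
    using I unfolding join_def by (auto simp: extensional_def restrict_def fun_eq_iff)
qed

lemma card_cols_split:
  assumes X: "finite X" and I: "I \<subseteq> X" "indep I"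
  shows "card {\<sigma> \<in> cols X. P \<sigma>}
    = (\<Sum>\<rho>\<in>cols (X - I). card {f \<in> PiE I (avail (X - I) \<rho>). P (join I \<rho> f)})"
proof -
  let ?S = "SIGMA \<rho> : cols (X - I). {f \<in> PiE I (avail (X - I) \<rho>). P (join I \<rho> f)}"
  have bij: "bij_betw (\<lambda>(\<rho>, f). join I \<rho> f) (SIGMA \<rho> : cols (X - I). PiE I (avail (X - I) \<rho>)) (cols X)"
    by (rule bij_betw_join[OF I])
  have "(\<lambda>(\<rho>, f). join I \<rho> f) ` ?S
      = {\<sigma> \<in> (\<lambda>(\<rho>, f). join I \<rho> f) ` (SIGMA \<rho> : cols (X - I). PiE I (avail (X - I) \<rho>)). P \<sigma>}"
    by auto
  also have "\<dots> = {\<sigma> \<in> cols X. P \<sigma>}" using bij by (simp add: bij_betw_def)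
  finally have image: "(\<lambda>(\<rho>, f). join I \<rho> f) ` ?S = {\<sigma> \<in> cols X. P \<sigma>}" .
  have "bij_betw (\<lambda>(\<rho>, f). join I \<rho> f) ?S {\<sigma> \<in> cols X. P \<sigma>}"
    by (rule bij_betw_subset[OF bij _ image]) auto
  then have "card {\<sigma> \<in> cols X. P \<sigma>} = card ?S" by (rule bij_betw_same_card[symmetric])
  also have "\<dots> = (\<Sum>\<rho>\<in>cols (X - I). card {f \<in> PiE I (avail (X - I) \<rho>). P (join I \<rho> f)})"
  proof (rule card_SigmaI)
    show "finite (cols (X - I))" using X by (intro finite_cols) auto
    have "finite (PiE I (avail (X - I) \<rho>))" for \<rho>
      by (rule finite_PiE[OF finite_subset[OF I(1) X] finite_avail])
    then show "\<forall>\<rho>\<in>cols (X - I). finite {f \<in> PiE I (avail (X - I) \<rho>). P (join I \<rho> f)}" by auto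
  qed
  finally show ?thesis .
qed

lemma card_cols_insert:
  assumes "finite X" "v \<notin> X"
  shows "card (cols (insert v X)) = (\<Sum>\<rho>\<in>cols X. card (avail X \<rho> v))"
  using card_cols_split[of "insert v X" "{v}" "\<lambda>_. True"] assms indep_single by (simp add: card_PiE)

text \<open>Whether the lists on \<open>I\<close> are all short depends on \<open>\<rho>\<close>
  alone. If they are, \<open>\<rho>\<close> has at most \<open>t ^ card I\<close> extensions;
  otherwise none of its extensions is counted.\<close>

lemma card_all_constrained_le:
  assumes X: "finite X" and I: "I \<subseteq> X" "indep I"
  shows "card {\<sigma> \<in> cols X. \<forall>w\<in>I. card (avail X \<sigma> w) \<le> t} \<le> t ^ card I * card (cols (X - I))"
proof -
  have finI: "finite I" using I X finite_subset by blast
  have "card {\<sigma> \<in> cols X. \<forall>w\<in>I. card (avail X \<sigma> w) \<le> t}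
      = (\<Sum>\<rho>\<in>cols (X - I). card {f \<in> PiE I (avail (X - I) \<rho>). \<forall>w\<in>I. card (avail (X - I) \<rho> w) \<le> t})"
    unfolding card_cols_split[OF X I] by (intro sum.cong) (auto simp: avail_join[OF I])
  also have "\<dots> \<le> (\<Sum>\<rho>\<in>cols (X - I). t ^ card I)"
  proof (rule sum_mono)
    fix \<rho>
    show "card {f \<in> PiE I (avail (X - I) \<rho>). \<forall>w\<in>I. card (avail (X - I) \<rho> w) \<le> t} \<le> t ^ card I"
    proof (cases "\<forall>w\<in>I. card (avail (X - I) \<rho> w) \<le> t")
      case True
      then have "(\<Prod>w\<in>I. card (avail (X - I) \<rho> w)) \<le> (\<Prod>w\<in>I. t)" by (intro prod_mono) auto
      then show ?thesis using True finI by (simp add: card_PiE)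
    next
      case False
      then have "{f \<in> PiE I (avail (X - I) \<rho>). \<forall>w\<in>I. card (avail (X - I) \<rho> w) \<le> t} = {}" by blast
      then show ?thesis by (metis card.empty le0)
    qed
  qed
  finally show ?thesis by (simp add: mult.commute)
qed

section \<open>Rosenfeld's induction: growth of the number of colourings\<close>

lemma card_nbrs_le:
  assumes "v \<in> V" "X \<subseteq> V"
  shows "card (nbrs X v) \<le> D"
proof -
  have "card (nbrs X v) \<le> card {w \<in> V. (v, w) \<in> E}"
    unfolding nbrs_def using assms finV by (intro card_mono) auto
  then show ?thesis using degree[OF assms(1)] by simp
qed

text \<open>The vertices of \<open>I\<close> are put back one at a time. Growth is assumed only from
  proper subsets \<open>Y\<close> of \<open>X\<close>, which is what the later induction on
  \<open>X\<close> supplies.\<close>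

lemma power_card_cols_le:
  assumes X: "finite X" and l: "0 < l"
    and growth: "\<And>Y v. Y \<subset> X \<Longrightarrow> v \<in> X - Y \<Longrightarrow> l * real (card (cols Y)) \<le> real (card (cols (insert v Y)))"
    and I: "I \<subseteq> X"
  shows "l ^ card I * real (card (cols (X - I))) \<le> real (card (cols X))"
  using finite_subset[OF I X] I
proof (induction I)
  case (insert i I)
  have "X - insert i I \<subset> X" "i \<in> X - (X - insert i I)" "insert i (X - insert i I) = X - I"
    using insert by auto
  then have "l * real (card (cols (X - insert i I))) \<le> real (card (cols (X - I)))"
    using growth by metis
  then have "l ^ card I * (l * real (card (cols (X - insert i I)))) \<le> l ^ card I * real (card (cols (X - I)))"
    using l by (intro mult_left_mono) auto
  also have "\<dots> \<le> real (card (cols X))" using insert by auto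
  finally show ?case using insert.hyps by (simp add: mult_ac)
qed simp

text \<open>The list sizes at the vertices of an independent set depend only on the colours outside it, so
  colourings with all these lists short are counted by deleting the set; the growth hypothesis
  pays for the deletion.\<close>

lemma card_many_constrained_le:
  assumes X: "X \<subseteq> V" and v: "v \<in> V" and l: "0 < l"
    and growth: "\<And>Y v. Y \<subset> X \<Longrightarrow> v \<in> X - Y \<Longrightarrow> l * real (card (cols Y)) \<le> real (card (cols (insert v Y)))"
  shows "real (card {\<sigma> \<in> cols X. r \<le> card {w \<in> nbrs X v. card (avail X \<sigma> w) \<le> t}})
    \<le> exp (real t * real D / l) / 2 ^ r * real (card (cols X))"
proof -
  have finX: "finite X" using X finV finite_subset by blast
  define N where "N = nbrs X v"
  have N: "finite N" "N \<subseteq> X" "indep N"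
    using finX indep_nbrs unfolding N_def by (auto simp: nbrs_def)
  have "2 ^ r * real (card {\<sigma> \<in> cols X. r \<le> card (N \<inter> {w. card (avail X \<sigma> w) \<le> t})})
      \<le> (\<Prod>w\<in>N. 1 + real t / l) * real (card (cols X))"
  proof (rule card_many_hits_le[OF finite_cols[OF finX] N(1)])
    fix I assume I: "I \<subseteq> N"
    have "indep I" "I \<subseteq> X" using I N unfolding indep_def by auto
    then have "card {\<sigma> \<in> cols X. I \<subseteq> {w. card (avail X \<sigma> w) \<le> t}} \<le> t ^ card I * card (cols (X - I))"
      using card_all_constrained_le[OF finX, of I t] by (simp add: subset_iff Ball_def)
    from of_nat_mono[OF this, where 'a = real] have "real (card {\<sigma> \<in> cols X. I \<subseteq> {w. card (avail X \<sigma> w) \<le> t}}) \<le> real t ^ card I * real (card (cols (X - I)))"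
      by simp
    also have "\<dots> = (real t / l) ^ card I * (l ^ card I * real (card (cols (X - I))))"
      using l by (simp add: power_divide)
    also have "\<dots> \<le> (real t / l) ^ card I * real (card (cols X))"
      using l power_card_cols_le[OF finX l growth \<open>I \<subseteq> X\<close>] by (intro mult_left_mono) auto
    finally show "real (card {\<sigma> \<in> cols X. I \<subseteq> {w. card (avail X \<sigma> w) \<le> t}})
        \<le> (\<Prod>w\<in>I. real t / l) * real (card (cols X))" by simp
  qed
  also have "(\<Prod>w\<in>N. 1 + real t / l) \<le> exp (real t / l) ^ card N"
    using l by (auto intro!: power_mono exp_ge_add_one_self add_nonneg_nonneg)
  also have "\<dots> = exp (real (card N) * (real t / l))" by (rule exp_of_nat_mult[symmetric])
  also have "\<dots> \<le> exp (real t * real D / l)"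
    using l card_nbrs_le[OF v X] mult_right_mono[of "real (card N)" "real D" "real t / l"]
    unfolding N_def by (simp add: mult.commute)
  finally have "2 ^ r * real (card {\<sigma> \<in> cols X. r \<le> card (N \<inter> {w. card (avail X \<sigma> w) \<le> t})})
    \<le> exp (real t * real D / l) * real (card (cols X))" by (simp add: mult_right_mono)
  then show ?thesis unfolding N_def by (simp add: field_simps Int_def)
qed

text \<open>Conditioning on the colours outside the neighbourhood \<open>N\<close> of
  \<open>v\<close> fixes the lists on \<open>N\<close> and the number of short ones, while the
  colours lost at \<open>v\<close> are exactly the values of a random \<open>f\<close> on
  \<open>N\<close>. Fewer than \<open>r\<close> short lists leave at least \<open>m\<close> colours
  outside them.\<close>

lemma card_few_avail_le:
  assumes X: "X \<subseteq> V" and v: "v \<in> V" and t: "0 < t"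
    and m: "0 < m" "m \<le> real k - real t * real r"
  shows "real (card {\<sigma> \<in> cols X. card {w \<in> nbrs X v. card (avail X \<sigma> w) \<le> t} < r \<and> card (avail X \<sigma> v) < s})
    \<le> 2 ^ s * exp (- (m * exp (- (real D * (1 + 1 / real t) / m))) / 2) * real (card (cols X))"
proof -
  have finX: "finite X" using X finV finite_subset by blast
  define N where "N = nbrs X v"
  have N: "finite N" "N \<subseteq> X" "indep N"
    using finX indep_nbrs unfolding N_def by (auto simp: nbrs_def)
  define q where "q = 2 ^ s * exp (- (m * exp (- (real D * (1 + 1 / real t) / m))) / 2)"
  have q: "0 \<le> q" unfolding q_def by simp
  have "real (card {\<sigma> \<in> cols X. card {w \<in> N. card (avail X \<sigma> w) \<le> t} < r \<and> card (avail X \<sigma> v) < s})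
     = (\<Sum>\<rho>\<in>cols (X - N). real (card {f \<in> PiE N (avail (X - N) \<rho>).
          card {w \<in> N. card (avail X (join N \<rho> f) w) \<le> t} < r \<and> card (avail X (join N \<rho> f) v) < s}))"
    unfolding card_cols_split[OF finX N(2,3)] by simp
  also have "\<dots> \<le> (\<Sum>\<rho>\<in>cols (X - N). q * real (card (PiE N (avail (X - N) \<rho>))))"
  proof (rule sum_mono)
    fix \<rho>
    let ?L = "avail (X - N) \<rho>"
    have bad: "{w \<in> N. card (avail X (join N \<rho> f) w) \<le> t} = {w \<in> N. card (?L w) \<le> t}" for f
      using avail_join[OF N(2,3)] by auto
    have av: "avail X (join N \<rho> f) v = {1..k} - f ` N" for f
    proof -
      have "join N \<rho> f ` N = f ` N" unfolding join_def by (intro image_cong) auto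
      then show ?thesis unfolding avail_def N_def by simp
    qed
    show "real (card {f \<in> PiE N ?L. card {w \<in> N. card (avail X (join N \<rho> f) w) \<le> t} < r
        \<and> card (avail X (join N \<rho> f) v) < s}) \<le> q * real (card (PiE N ?L))"
    proof (cases "card {w \<in> N. card (?L w) \<le> t} < r")
      case True
      then have "real t * real (card {w \<in> N. card (?L w) \<le> t}) \<le> real t * real r"
        by (intro mult_left_mono) auto
      then have "m \<le> real (card {1..k}) - real t * real (card {w \<in> N. card (?L w) \<le> t})"
        using m by simp
      moreover have "card N \<le> D" using card_nbrs_le[OF v X] unfolding N_def .
      ultimately have "real (card {f \<in> PiE N ?L. card ({1..k} - f ` N) < s}) \<le> q * real (card (PiE N ?L))"
        unfolding q_def using t m by (intro card_few_colours_left_le[OF N(1)]) (auto simp: avail_def)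
      then show ?thesis using True by (simp add: bad av)
    next
      case False
      then show ?thesis using q by (simp add: bad)
    qed
  qed
  also have "\<dots> = q * real (card (cols X))"
    using card_cols_split[OF finX N(2,3), of "\<lambda>_. True"] by (simp add: sum_distrib_left)
  finally show ?thesis unfolding N_def q_def .
qed

text \<open>Both claims are proved together by strong induction on \<open>X\<close>. Growth by
  \<open>s / 2\<close> on smaller sets bounds the case of many short lists, the first term of
  \<open>p\<close>; the second term covers few short lists. As \<open>p \<le> 1 / 2\<close>, at
  least half of the colourings leave \<open>s\<close> choices for \<open>v\<close>, which is growth
  at \<open>X\<close>.\<close>

lemma card_cols_growth:
  assumes t: "0 < t" and s: "0 < s" and m: "0 < m" "m \<le> real k - real t * real r"
    and p: "p = exp (real t * real D / (real s / 2)) / 2 ^ r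
      + 2 ^ s * exp (- (m * exp (- (real D * (1 + 1 / real t) / m))) / 2)"
    and p_half: "p \<le> 1 / 2"
    and X: "X \<subseteq> V" and v: "v \<in> V - X"
  shows "real (card {\<sigma> \<in> cols X. card (avail X \<sigma> v) < s}) \<le> p * real (card (cols X))"
    and "real s / 2 * real (card (cols X)) \<le> real (card (cols (insert v X)))"
proof -
  have main: "real (card {\<sigma> \<in> cols X. card (avail X \<sigma> v) < s}) \<le> p * real (card (cols X))
     \<and> real s / 2 * real (card (cols X)) \<le> real (card (cols (insert v X)))"
    using finite_subset[OF X finV] X v
  proof (induction X arbitrary: v rule: finite_psubset_induct)
    case (psubset X)
    let ?bad = "\<lambda>\<sigma>. card {w \<in> nbrs X v. card (avail X \<sigma> w) \<le> t}"
    have v: "v \<in> V" "v \<notin> X" using psubset by auto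
    have growth: "real s / 2 * real (card (cols Y)) \<le> real (card (cols (insert u Y)))"
      if "Y \<subset> X" "u \<in> X - Y" for Y u
      using psubset.IH[of Y u] psubset.prems that by blast
    have fin: "finite (cols X)" by (rule finite_cols[OF psubset.hyps])
    have "{\<sigma> \<in> cols X. card (avail X \<sigma> v) < s} \<subseteq> {\<sigma> \<in> cols X. r \<le> ?bad \<sigma>} \<union>
         {\<sigma> \<in> cols X. ?bad \<sigma> < r \<and> card (avail X \<sigma> v) < s}" by auto
    then have "card {\<sigma> \<in> cols X. card (avail X \<sigma> v) < s} \<le> card ({\<sigma> \<in> cols X. r \<le> ?bad \<sigma>} \<union>
         {\<sigma> \<in> cols X. ?bad \<sigma> < r \<and> card (avail X \<sigma> v) < s})"
      using fin by (intro card_mono) auto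
    also have "\<dots> \<le> card {\<sigma> \<in> cols X. r \<le> ?bad \<sigma>} + card {\<sigma> \<in> cols X. ?bad \<sigma> < r \<and> card (avail X \<sigma> v) < s}"
      by (rule card_Un_le)
    also have "real \<dots> \<le> p * real (card (cols X))"
      using card_many_constrained_le[OF psubset.prems(1) v(1) _ growth, of r t]
        card_few_avail_le[OF psubset.prems(1) v(1) t m, of s] s
      unfolding p by (simp add: ring_distribs)
    finally have few: "real (card {\<sigma> \<in> cols X. card (avail X \<sigma> v) < s}) \<le> p * real (card (cols X))"
      by simp
    have "card (cols X) = card {\<sigma> \<in> cols X. card (avail X \<sigma> v) < s} + card {\<sigma> \<in> cols X. s \<le> card (avail X \<sigma> v)}"
      using fin by (subst card_Un_disjoint[symmetric]) (auto intro: arg_cong[where f = card])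
    moreover have "p * real (card (cols X)) \<le> 1 / 2 * real (card (cols X))"
      using p_half by (intro mult_right_mono) auto
    ultimately have half: "real (card (cols X)) / 2 \<le> real (card {\<sigma> \<in> cols X. s \<le> card (avail X \<sigma> v)})"
      using few by simp
    have "real s / 2 * real (card (cols X)) \<le> real s * real (card {\<sigma> \<in> cols X. s \<le> card (avail X \<sigma> v)})"
      using mult_left_mono[OF half, of "real s"] by simp
    also have "\<dots> = (\<Sum>\<sigma>\<in>{\<sigma> \<in> cols X. s \<le> card (avail X \<sigma> v)}. real s)" by simp
    also have "\<dots> \<le> (\<Sum>\<sigma>\<in>{\<sigma> \<in> cols X. s \<le> card (avail X \<sigma> v)}. real (card (avail X \<sigma> v)))"
      by (intro sum_mono) auto
    also have "\<dots> \<le> (\<Sum>\<sigma>\<in>cols X. real (card (avail X \<sigma> v)))"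
      by (intro sum_mono2) (use fin in auto)
    also have "\<dots> = real (card (cols (insert v X)))"
      using card_cols_insert[OF psubset.hyps v(2)] by simp
    finally show ?case using few by simp
  qed
  then show "real (card {\<sigma> \<in> cols X. card (avail X \<sigma> v) < s}) \<le> p * real (card (cols X))"
    and "real s / 2 * real (card (cols X)) \<le> real (card (cols (insert v X)))" by auto
qed

text \<open>Existence follows by growth from the single colouring of the empty set. For the other
  bound, \<open>u\<close> is removed: a colouring of the rest leaving fewer than two colours for
  \<open>u\<close> extends in at most one way, and it leaves fewer than \<open>s\<close>
  colours.\<close>

lemma
  assumes t: "0 < t" and s: "2 \<le> s" and m: "0 < m" "m \<le> real k - real t * real r"
    and p: "p = exp (real t * real D / (real s / 2)) / 2 ^ r
      + 2 ^ s * exp (- (m * exp (- (real D * (1 + 1 / real t) / m))) / 2)"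
    and p_half: "p \<le> 1 / 2"
  shows cols_nonempty: "cols V \<noteq> {}"
    and card_frozen_le: "u \<in> V \<Longrightarrow> real (card {\<sigma> \<in> cols V. card (avail V \<sigma> u) < 2}) \<le> p * real (card (cols V))"
proof -
  have s0: "0 < s" using s by simp
  note growth = card_cols_growth[OF t s0 m p p_half]
  have "(real s / 2) ^ card V * real (card (cols (V - V))) \<le> real (card (cols V))"
    using s growth(2) by (intro power_card_cols_le[OF finV]) auto
  moreover have "cols {} = {\<lambda>_. undefined}" unfolding cols_def by auto
  moreover have "0 < (real s / 2) ^ card V" using s0 by simp
  ultimately have "0 < real (card (cols V))" by simp
  then show "cols V \<noteq> {}" by auto
  assume u: "u \<in> V"
  define X where "X = V - {u}"
  have X: "X \<subseteq> V" "u \<in> V - X" "finite X" "insert u X = V" using u finV unfolding X_def by auto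
  have av: "avail V (join {u} \<rho> f) u = avail X \<rho> u" for \<rho> f
    using avail_join[of "{u}" V u] indep_single u unfolding X_def by simp
  have "card {\<sigma> \<in> cols V. card (avail V \<sigma> u) < 2}
      = (\<Sum>\<rho>\<in>cols X. card {f \<in> PiE {u} (avail X \<rho>). card (avail X \<rho> u) < 2})"
    using card_cols_split[OF finV _ indep_single, of u "\<lambda>\<sigma>. card (avail V \<sigma> u) < 2"] u
    by (simp add: av flip: X_def)
  also have "\<dots> \<le> (\<Sum>\<rho>\<in>cols X. of_bool (card (avail X \<rho> u) < s))"
  proof (rule sum_mono)
    fix \<rho>
    show "card {f \<in> PiE {u} (avail X \<rho>). card (avail X \<rho> u) < 2} \<le> of_bool (card (avail X \<rho> u) < s)"
      using s by (cases "card (avail X \<rho> u) < 2") (auto simp: card_PiE)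
  qed
  also have "\<dots> = card {\<rho> \<in> cols X. card (avail X \<rho> u) < s}"
    using finite_cols[OF X(3)] by (simp add: of_bool_def sum.If_cases Int_def)
  finally have "real (card {\<sigma> \<in> cols V. card (avail V \<sigma> u) < 2}) \<le> p * real (card (cols X))"
    using growth(1)[OF X(1,2)] by simp
  \<comment> \<open>\<open>2 \<le> s\<close> makes the growth factor at least 1, so passing from
    \<open>cols X\<close> to \<open>cols V\<close> only enlarges the bound.\<close>
  also have "\<dots> \<le> p * (real s / 2 * real (card (cols X)))"
    using s mult_right_mono[of 1 "real s / 2" "real (card (cols X))"] unfolding p
    by (intro mult_left_mono) auto
  also have "\<dots> \<le> p * real (card (cols V))"
    using growth(2)[OF X(1,2)] X(4) unfolding p by (intro mult_left_mono) auto
  finally show "real (card {\<sigma> \<in> cols V. card (avail V \<sigma> u) < 2}) \<le> p * real (card (cols V))" .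
qed

end

subsection \<open>Choice of parameters\<close>

text \<open>Here \<open>t\<close> is constant, \<open>s\<close> is about
  \<open>(ln k)\<^sup>2\<close>, and \<open>r\<close> and \<open>k - m\<close> are small linear
  fractions of \<open>k\<close>. In the first term of \<open>p\<close>, an exponent of order at most
  \<open>k / ln k\<close> loses against a linear one; in the second, \<open>2 ^ s\<close> loses
  against \<open>exp (- 3 / 8 * k powr (\<epsilon> / 2))\<close>. The factor \<open>D\<close>
  anticipates a union bound over neighbours.\<close>

lemma colouring_parameters_exist:
  fixes \<epsilon> :: real
  assumes \<epsilon>: "0 < \<epsilon>" "\<epsilon> < 1"
  shows "\<exists>k\<^sub>0::nat. \<forall>k\<ge>k\<^sub>0. \<forall>D::nat. real D \<le> (1 - \<epsilon>) * real k * ln (real k) \<longrightarrow>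
    (\<exists>t s r :: nat. \<exists>m p :: real. 0 < t \<and> 2 \<le> s \<and> 0 < m \<and> m \<le> real k - real t * real r \<and>
      p = exp (real t * real D / (real s / 2)) / 2 ^ r
        + 2 ^ s * exp (- (m * exp (- (real D * (1 + 1 / real t) / m))) / 2) \<and>
      p \<le> 1 / 2 \<and> real D * p \<le> exp (- (real D powr (\<epsilon> / 3))))"
proof -
  define t where "t = nat \<lceil>4 / \<epsilon>\<rceil>"
  have t_ge: "4 / \<epsilon> \<le> real t" unfolding t_def by (rule real_nat_ceiling_ge)
  have t0: "0 < real t" using t_ge \<epsilon> by (smt (verit) divide_pos_pos)
  have t_inv: "1 / real t \<le> \<epsilon> / 4" using t_ge t0 \<epsilon> by (simp add: field_simps)
  \<comment> \<open>Chosen so that \<open>t * r\<close> is at most \<open>\<epsilon> / 8 * k\<close>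
    up to rounding.\<close>
  define \<delta> where "\<delta> = \<epsilon> / (8 * real t)"
  have \<delta>: "0 < \<delta>" "real t * \<delta> = \<epsilon> / 8" using \<epsilon> t0 by (auto simp: \<delta>_def)
  define T where "T = 2 * real t"
  define c where "c = ln 2 * \<delta>"
  have c: "0 < c" using \<delta> by (simp add: c_def)
  define e where "e = \<epsilon> / 3"
  have e: "0 < e" "e < 1" "e < \<epsilon> / 2" using \<epsilon> by (auto simp: e_def)
  \<comment> \<open>\<open>e < \<epsilon> / 2\<close> makes \<open>(x * ln x) powr e\<close>
    negligible against \<open>x powr (\<epsilon> / 2)\<close>. The last condition absorbs the
    rounding of \<open>r\<close>, which costs at most \<open>t\<close>.\<close>
  have ev: "eventually (\<lambda>x::real. x * ln x * exp (T * x / ln x - c * x) \<le> exp (- ((x * ln x) powr e)) / 2) at_top"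
    "eventually (\<lambda>x::real. x * ln x * (2 * exp ((ln x)\<^sup>2 - 3 / 8 * x powr (\<epsilon> / 2))) \<le> exp (- ((x * ln x) powr e)) / 2) at_top"
    "eventually (\<lambda>x::real. exp (- ((x * ln x) powr e)) \<le> 1 / 2) at_top"
    "eventually (\<lambda>x::real. 2 \<le> ln x) at_top"
    "eventually (\<lambda>x::real. 8 * real t / \<epsilon> \<le> x) at_top"
    using e c by real_asymp+
  have "eventually (\<lambda>x::real. x * ln x * exp (T * x / ln x - c * x) \<le> exp (- ((x * ln x) powr e)) / 2
      \<and> x * ln x * (2 * exp ((ln x)\<^sup>2 - 3 / 8 * x powr (\<epsilon> / 2))) \<le> exp (- ((x * ln x) powr e)) / 2
      \<and> exp (- ((x * ln x) powr e)) \<le> 1 / 2 \<and> 2 \<le> ln x \<and> 8 * real t / \<epsilon> \<le> x \<and> 1 \<le> x) at_top"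
    using ev eventually_ge_at_top[of 1] by eventually_elim auto
  then obtain x\<^sub>0 where x\<^sub>0: "\<And>x::real. x \<ge> x\<^sub>0 \<Longrightarrow> x * ln x * exp (T * x / ln x - c * x) \<le> exp (- ((x * ln x) powr e)) / 2
      \<and> x * ln x * (2 * exp ((ln x)\<^sup>2 - 3 / 8 * x powr (\<epsilon> / 2))) \<le> exp (- ((x * ln x) powr e)) / 2
      \<and> exp (- ((x * ln x) powr e)) \<le> 1 / 2 \<and> 2 \<le> ln x \<and> 8 * real t / \<epsilon> \<le> x \<and> 1 \<le> x"
    unfolding eventually_at_top_linorder by auto
  show ?thesis
  proof (rule exI[of _ "nat \<lceil>x\<^sub>0\<rceil>"], intro allI impI)
    fix k D :: nat
    assume "nat \<lceil>x\<^sub>0\<rceil> \<le> k" and D: "real D \<le> (1 - \<epsilon>) * real k * ln (real k)"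
    then have "x\<^sub>0 \<le> real k" by linarith
    define x where "x = real k"
    have large: "x * ln x * exp (T * x / ln x - c * x) \<le> exp (- ((x * ln x) powr e)) / 2"
      "x * ln x * (2 * exp ((ln x)\<^sup>2 - 3 / 8 * x powr (\<epsilon> / 2))) \<le> exp (- ((x * ln x) powr e)) / 2"
      "exp (- ((x * ln x) powr e)) \<le> 1 / 2" "2 \<le> ln x" "8 * real t / \<epsilon> \<le> x" "1 \<le> x"
      using x\<^sub>0[of x] \<open>x\<^sub>0 \<le> real k\<close> by (auto simp: x_def)
    have xln: "1 \<le> x * ln x" using mult_mono[of 1 x 1 "ln x"] large by simp
    have Dx: "real D \<le> (1 - \<epsilon>) * (x * ln x)" using D by (simp add: x_def mult.assoc)
    also have "\<dots> \<le> 1 * (x * ln x)" using xln \<epsilon> by (intro mult_right_mono) auto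
    finally have Dx1: "real D \<le> x * ln x" by simp
    \<comment> \<open>The square makes \<open>t * D / s\<close> of order at most
      \<open>k / ln k\<close>, negligible against \<open>r\<close>, while \<open>s\<close> stays
      below every positive power of \<open>k\<close> for large \<open>k\<close>.\<close>
    define s where "s = nat \<lceil>(ln x)\<^sup>2\<rceil>"
    define r where "r = nat \<lceil>\<delta> * x\<rceil>"
    define m where "m = (1 - \<epsilon> / 4) * x"
    define p where "p = exp (real t * real D / (real s / 2)) / 2 ^ r
        + 2 ^ s * exp (- (m * exp (- (real D * (1 + 1 / real t) / m))) / 2)"
    have s: "(ln x)\<^sup>2 \<le> real s" "real s \<le> (ln x)\<^sup>2 + 1" unfolding s_def by (auto intro: real_nat_ceiling_ge of_nat_ceiling)
    have r: "\<delta> * x \<le> real r" "real r \<le> \<delta> * x + 1" 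
      using \<delta> large unfolding r_def by (auto intro: real_nat_ceiling_ge of_nat_ceiling)
    have "4 \<le> (ln x)\<^sup>2" using power_mono[of 2 "ln x" 2] large by simp
    then have s2: "2 \<le> s" using s by linarith
    have m0: "0 < m" using \<epsilon> large by (simp add: m_def)
    have "real t * real r \<le> real t * (\<delta> * x + 1)" using r t0 by (intro mult_left_mono) auto
    also have "\<dots> = \<epsilon> / 8 * x + real t" by (simp add: ring_distribs \<delta>(2) flip: mult.assoc)
    also have "\<dots> \<le> \<epsilon> / 8 * x + \<epsilon> / 8 * x" using large(5) \<epsilon> by (simp add: field_simps)
    finally have mr: "m \<le> real k - real t * real r" by (simp add: m_def x_def algebra_simps)
    have first: "exp (real t * real D / (real s / 2)) / 2 ^ r \<le> exp (T * x / ln x - c * x)"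
    proof -
      have "real t * real D / (real s / 2) \<le> real t * (x * ln x) / ((ln x)\<^sup>2 / 2)"
        using Dx1 s large t0 by (intro frac_le mult_left_mono divide_right_mono mult_nonneg_nonneg) auto
      also have "\<dots> = T * x / ln x" using large by (simp add: T_def power2_eq_square)
      finally have "exp (real t * real D / (real s / 2)) \<le> exp (T * x / ln x)" by simp
      moreover have "exp (c * x) \<le> 2 ^ r"
      proof -
        have "exp (c * x) = 2 powr (\<delta> * x)" by (simp add: powr_def c_def mult_ac)
        also have "\<dots> \<le> 2 powr real r" using r by (intro powr_mono) auto
        also have "\<dots> = 2 ^ r" by (simp add: powr_realpow)
        finally show ?thesis .
      qed
      ultimately have "exp (real t * real D / (real s / 2)) / 2 ^ r \<le> exp (T * x / ln x) / exp (c * x)"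
        by (intro frac_le) auto
      then show ?thesis by (simp add: exp_diff)
    qed
    have second: "2 ^ s * exp (- (m * exp (- (real D * (1 + 1 / real t) / m))) / 2)
        \<le> 2 * exp ((ln x)\<^sup>2 - 3 / 8 * x powr (\<epsilon> / 2))"
    proof -
      have "(2::real) ^ s = 2 powr real s" by (simp add: powr_realpow)
      also have "\<dots> \<le> 2 powr ((ln x)\<^sup>2 + 1)" using s by (intro powr_mono) auto
      also have "\<dots> = 2 * exp ((ln x)\<^sup>2 * ln 2)" by (simp add: powr_def ring_distribs exp_add)
      also have "\<dots> \<le> 2 * exp ((ln x)\<^sup>2 * 1)"
        using ln_2_less_1 by (intro mult_left_mono iffD2[OF exp_le_cancel_iff]) auto
      finally have two_s: "2 ^ s \<le> 2 * exp ((ln x)\<^sup>2)" by simp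
      \<comment> \<open>the choice of \<open>t\<close> and \<open>m\<close> costs only half of the \<open>\<epsilon>\<close> in the exponent of \<open>k\<close>\<close>
      have "(1 - \<epsilon>) * (1 + \<epsilon> / 4) \<le> (1 - \<epsilon> / 2) * (1 - \<epsilon> / 4)"
        by (simp add: algebra_simps)
      then have "(1 - \<epsilon>) * (1 + \<epsilon> / 4) * (x * ln x) \<le> (1 - \<epsilon> / 2) * (1 - \<epsilon> / 4) * (x * ln x)"
        using xln by (intro mult_right_mono) auto
      moreover have "real D * (1 + 1 / real t) \<le> (1 - \<epsilon>) * (x * ln x) * (1 + \<epsilon> / 4)"
        using Dx t_inv t0 xln \<epsilon> by (intro mult_mono) auto
      ultimately have "real D * (1 + 1 / real t) \<le> ((1 - \<epsilon> / 2) * ln x) * m"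
        by (simp add: m_def mult_ac)
      then have "real D * (1 + 1 / real t) / m \<le> (1 - \<epsilon> / 2) * ln x"
        using m0 by (simp add: pos_divide_le_eq)
      then have "m * exp (- ((1 - \<epsilon> / 2) * ln x)) \<le> m * exp (- (real D * (1 + 1 / real t) / m))"
        using m0 by (intro mult_left_mono) auto
      moreover have "m * exp (- ((1 - \<epsilon> / 2) * ln x)) = (1 - \<epsilon> / 4) * x powr (\<epsilon> / 2)"
      proof -
        have "x powr (\<epsilon> / 2) = exp (\<epsilon> / 2 * ln x)" using large(6) by (simp add: powr_def)
        also have "\<dots> = exp (ln x + - ((1 - \<epsilon> / 2) * ln x))" by (simp add: algebra_simps)
        also have "\<dots> = x * exp (- ((1 - \<epsilon> / 2) * ln x))" unfolding exp_add using large(6) by simp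
        finally show ?thesis by (simp add: m_def)
      qed
      moreover have "3 / 4 * x powr (\<epsilon> / 2) \<le> (1 - \<epsilon> / 4) * x powr (\<epsilon> / 2)"
        using \<epsilon> by (intro mult_right_mono) auto
      ultimately have "3 / 4 * x powr (\<epsilon> / 2) \<le> m * exp (- (real D * (1 + 1 / real t) / m))"
        by linarith
      then have "exp (- (m * exp (- (real D * (1 + 1 / real t) / m))) / 2) \<le> exp (- (3 / 8 * x powr (\<epsilon> / 2)))"
        by simp
      from mult_mono[OF two_s this] show ?thesis by (simp add: mult.assoc flip: exp_add)
    qed
    have p0: "0 \<le> p" unfolding p_def by simp
    have "x * ln x * p \<le> x * ln x * (exp (T * x / ln x - c * x) + 2 * exp ((ln x)\<^sup>2 - 3 / 8 * x powr (\<epsilon> / 2)))"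
      using first second xln unfolding p_def by (intro mult_left_mono) auto
    also have "\<dots> \<le> exp (- ((x * ln x) powr e))"
      using large(1,2) by (simp only: ring_distribs)
    finally have xp: "x * ln x * p \<le> exp (- ((x * ln x) powr e))" .
    \<comment> \<open>The bound \<open>xp\<close> serves twice: \<open>x * ln x\<close> is at least
      1, which controls \<open>p\<close>, and at least \<open>D\<close>, which controls
      \<open>D * p\<close>.\<close>
    have "1 * p \<le> x * ln x * p" using xln p0 by (intro mult_right_mono) auto
    then have p_half: "p \<le> 1 / 2" using xp large(3) by linarith
    have "real D * p \<le> x * ln x * p" using Dx1 p0 by (intro mult_right_mono) auto
    also note xp
    also have "exp (- ((x * ln x) powr e)) \<le> exp (- (real D powr (\<epsilon> / 3)))"
      using Dx1 e by (auto simp flip: e_def intro!: powr_mono2)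
    finally have "real D * p \<le> exp (- (real D powr (\<epsilon> / 3)))" .
    then show "\<exists>t s r :: nat. \<exists>m p :: real. 0 < t \<and> 2 \<le> s \<and> 0 < m \<and> m \<le> real k - real t * real r \<and>
      p = exp (real t * real D / (real s / 2)) / 2 ^ r
        + 2 ^ s * exp (- (m * exp (- (real D * (1 + 1 / real t) / m))) / 2) \<and>
      p \<le> 1 / 2 \<and> real D * p \<le> exp (- (real D powr (\<epsilon> / 3)))"
      using t0 s2 m0 mr p_half unfolding p_def by (metis of_nat_0_less_iff)
  qed
qed

subsection \<open>Recolouring the neighbourhood of a vertex\<close>

context triangle_free_graph begin

lemma join_in_cols:
  assumes \<sigma>: "\<sigma> \<in> cols V" and A: "A \<subseteq> V" "indep A" and a: "\<And>x. x \<in> A \<Longrightarrow> a x \<in> avail V \<sigma> x"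
  shows "join A \<sigma> a \<in> cols V"
proof -
  have "join A \<sigma> a \<in> V \<rightarrow>\<^sub>E {1..k}"
    using \<sigma> A a unfolding cols_def join_def avail_def by (auto simp: PiE_iff extensional_def)
  moreover have "join A \<sigma> a u \<noteq> join A \<sigma> a w" if "u \<in> V" "w \<in> V" "(u, w) \<in> E" for u w
  proof -
    have *: "a x \<noteq> \<sigma> y" if "x \<in> A" "y \<in> V" "(x, y) \<in> E" for x y
      using a[OF that(1)] that unfolding avail_def nbrs_def by auto
    have "\<sigma> u \<noteq> \<sigma> w" using \<sigma> that unfolding cols_def by auto
    then show ?thesis
      using that *[of u w] *[of w u] sym A(2) unfolding join_def indep_def by (auto split: if_splits)
  qed
  ultimately show ?thesis unfolding cols_def by auto
qed

text \<open>\<open>U\<close> consists of the neighbours of \<open>v\<close> coloured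
  \<open>j\<close>, and \<open>a\<close> gives each of them an available colour other than
  \<open>j\<close>. All subsets \<open>A\<close> of \<open>U\<close> are covered so that
  \<open>U\<close> can be recoloured one vertex at a time.\<close>

lemma recolouring_exists:
  assumes \<sigma>: "\<sigma> \<in> cols V" and v: "v \<in> V" and j: "j \<in> {1..k}" "\<sigma> v \<noteq> j"
    and slack: "\<And>u. u \<in> nbrs V v \<Longrightarrow> 2 \<le> card (avail V \<sigma> u)"
  obtains U a where "U \<subseteq> nbrs V v"
    and "\<And>A. A \<subseteq> U \<Longrightarrow> join A \<sigma> a \<in> cols V"
    and "join {v} (join U \<sigma> a) (\<lambda>_. j) \<in> cols V"
proof -
  define U where "U = {u \<in> nbrs V v. \<sigma> u = j}"
  have "\<exists>b. b \<in> avail V \<sigma> u \<and> b \<noteq> j" if u: "u \<in> nbrs V v" for u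
  proof (rule ccontr)
    assume "\<not> ?thesis"
    then have "avail V \<sigma> u \<subseteq> {j}" by auto
    then have "card (avail V \<sigma> u) \<le> card {j}" by (intro card_mono) auto
    then show False using slack[OF u] by simp
  qed
  then obtain a where a: "\<And>u. u \<in> nbrs V v \<Longrightarrow> a u \<in> avail V \<sigma> u \<and> a u \<noteq> j" by metis
  have UV: "U \<subseteq> nbrs V v" "nbrs V v \<subseteq> V" unfolding U_def nbrs_def by auto
  have cols: "join A \<sigma> a \<in> cols V" if "A \<subseteq> U" for A
  proof (rule join_in_cols[OF \<sigma>])
    show "indep A" using that UV indep_nbrs[of V v] unfolding indep_def by blast
  qed (use that UV a in auto)
  have "j \<notin> join U \<sigma> a ` nbrs V v" using a unfolding join_def U_def by auto
  then have "j \<in> avail V (join U \<sigma> a) v" using j unfolding avail_def by auto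
  then have "join {v} (join U \<sigma> a) (\<lambda>_. j) \<in> cols V"
    using v by (intro join_in_cols[OF cols[OF order.refl]] indep_single) auto
  then show thesis using that UV cols by blast
qed

end

section \<open>Paths and clusters in the colouring graph\<close>

lemma pair_wf_colouring_graph: "pair_wf_digraph (colouring_graph G k t)"
  by unfold_locales (auto simp: colouring_graph_def)

lemma symmetric_colouring_graph: "symmetric (with_proj (colouring_graph G k t))"
  unfolding symmetric_def colouring_graph_def hamming_dist_def
  by (auto intro!: symI simp: eq_commute)

text \<open>One-way reachability suffices: the arc relation is symmetric, so a reachable colouring
  lies in the same strongly connected component.\<close>

lemma thawedI:
  assumes \<tau>: "\<tau> \<in> proper_colourings G k"
    and reach: "\<And>j. j \<in> {1..k} \<Longrightarrow> \<exists>\<sigma>. \<tau> \<rightarrow>\<^sup>*\<^bsub>with_proj (colouring_graph G k t)\<^esub> \<sigma> \<and> \<sigma> v = j"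
  shows "thawed G k t \<tau> v"
  unfolding thawed_def
proof
  interpret H: pair_wf_digraph "colouring_graph G k t" by (rule pair_wf_colouring_graph)
  fix j assume "j \<in> {1..k}"
  then obtain \<sigma> where \<sigma>: "\<tau> \<rightarrow>\<^sup>*\<^bsub>with_proj (colouring_graph G k t)\<^esub> \<sigma>" "\<sigma> v = j" using reach by blast
  have \<tau>V: "\<tau> \<in> pverts (colouring_graph G k t)" using \<tau> by (simp add: colouring_graph_def)
  have "H.scc_of \<tau> \<in> clusters G k t"
    unfolding clusters_def using \<tau>V by (rule H.scc_of_in_sccs_verts)
  moreover have "\<tau> \<in> H.scc_of \<tau>" using \<tau>V by (simp add: H.scc_of_def)
  moreover have "\<sigma> \<in> H.scc_of \<tau>"
    using \<sigma>(1) symmetric_reachable[OF symmetric_colouring_graph \<sigma>(1)] by (simp add: H.scc_of_def)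
  ultimately show "\<exists>C\<in>clusters G k t. \<exists>\<sigma>. \<tau> \<in> C \<and> \<sigma> \<in> C \<and> \<sigma> v = j" using \<sigma>(2) by blast
qed

text \<open>Distance 0 is allowed and needs a separate case, since the colouring graph has no
  loops.\<close>

lemma reachable_colouring_graph_step:
  assumes "\<tau> \<rightarrow>\<^sup>*\<^bsub>with_proj (colouring_graph G k t)\<^esub> \<sigma>" "\<sigma> \<in> proper_colourings G k"
    and "\<sigma>' \<in> proper_colourings G k" "hamming_dist G \<sigma> \<sigma>' \<le> t"
  shows "\<tau> \<rightarrow>\<^sup>*\<^bsub>with_proj (colouring_graph G k t)\<^esub> \<sigma>'"
proof -
  interpret H: pair_wf_digraph "colouring_graph G k t" by (rule pair_wf_colouring_graph)
  show ?thesis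
  proof (cases "\<sigma> = \<sigma>'")
    case False
    then have "(\<sigma>, \<sigma>') \<in> parcs (colouring_graph G k t)"
      using assms by (simp add: colouring_graph_def)
    then show ?thesis using assms(1) by (meson H.reachable_adj_trans)
  qed (use assms in simp)
qed

section \<open>From the given graph to the counting setting\<close>

lemma triangle_free_graphI:
  assumes G: "pair_graph G" "triangle_free G" and deg: "\<forall>u \<in> pverts G. out_degree (with_proj G) u \<le> D"
  shows "triangle_free_graph (pverts G) (parcs G) D"
proof
  interpret pair_graph G by fact
  show "finite (pverts G)" by (rule pair_finite_verts)
  show "(w, u) \<in> parcs G" if "(u, w) \<in> parcs G" for u w
    using that pair_sym_arcs by (auto simp: symmetric_def dest: symD)
  show "(u, u) \<notin> parcs G" for u using pair_no_loops[of "(u, u)"] by auto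
  show "(w, u) \<notin> parcs G" if "(u, v) \<in> parcs G" "(v, w) \<in> parcs G" for u v w
    using that G(2) unfolding triangle_free_def by blast
  show "card {w \<in> pverts G. (u, w) \<in> parcs G} \<le> D" if u: "u \<in> pverts G" for u
  proof -
    have "card {w \<in> pverts G. (u, w) \<in> parcs G} = card (Pair u ` {w \<in> pverts G. (u, w) \<in> parcs G})"
      by (simp add: card_image inj_on_def)
    also have "Pair u ` {w \<in> pverts G. (u, w) \<in> parcs G} = out_arcs (with_proj G) u"
      using in_arcsD2 by (auto simp: out_arcs_def)
    finally show ?thesis using deg u by (simp add: out_degree_def)
  qed
qed

lemma (in triangle_free_graph) cols_eq_proper_colourings:
  assumes "pair_graph G" "V = pverts G" "E = parcs G"
  shows "cols V = proper_colourings G k"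
proof -
  interpret G: pair_graph G by fact
  show ?thesis
    unfolding cols_def proper_colourings_def using assms(2,3) G.in_arcsD1 G.in_arcsD2 by blast
qed

text \<open>One recolouring proves both: performed at once it changes at most \<open>U\<close> and
  \<open>v\<close>, giving looseness; performed vertex by vertex it is a path with steps of distance
  at most 1, giving thawedness.\<close>

lemma loose_and_thawed_if_slack:
  assumes G: "pair_graph G" "triangle_free G" and deg: "\<forall>u \<in> pverts G. out_degree (with_proj G) u \<le> D"
    and \<sigma>: "\<sigma> \<in> proper_colourings G k" and v: "v \<in> pverts G"
    and slack: "\<And>u. u \<in> triangle_free_graph.nbrs (parcs G) (pverts G) v \<Longrightarrow>
      2 \<le> card (triangle_free_graph.avail (parcs G) k (pverts G) \<sigma> u)"
  shows "loose G k (D + 1) \<sigma> v" "thawed G k 1 \<sigma> v"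
proof -
  interpret T: triangle_free_graph "pverts G" "parcs G" k D by (rule triangle_free_graphI[OF G deg])
  note cols_eq = T.cols_eq_proper_colourings[OF G(1) refl refl]
  interpret H: pair_wf_digraph "colouring_graph G k 1" by (rule pair_wf_colouring_graph)
  have refl: "\<sigma> \<rightarrow>\<^sup>*\<^bsub>with_proj (colouring_graph G k 1)\<^esub> \<sigma>"
    using \<sigma> by (intro H.reachable_refl) (simp add: colouring_graph_def)
  have dist: "hamming_dist G \<tau> \<tau>' \<le> card A" if "finite A" "\<And>x. x \<notin> A \<Longrightarrow> \<tau> x = \<tau>' x" for \<tau> \<tau>' A
    unfolding hamming_dist_def using that by (intro card_mono) force+
  have ex: "\<exists>\<sigma>'. (\<sigma>, \<sigma>') \<in> parcs (colouring_graph G k (D + 1)) \<and>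
      \<sigma> \<rightarrow>\<^sup>*\<^bsub>with_proj (colouring_graph G k 1)\<^esub> \<sigma>' \<and> \<sigma>' v = j"
    if j: "j \<in> {1..k}" "\<sigma> v \<noteq> j" for j
  proof -
    obtain U a where U: "U \<subseteq> T.nbrs (pverts G) v"
      and cols: "\<And>A. A \<subseteq> U \<Longrightarrow> T.join A \<sigma> a \<in> proper_colourings G k"
      and cols': "T.join {v} (T.join U \<sigma> a) (\<lambda>_. j) \<in> proper_colourings G k"
      using T.recolouring_exists[of \<sigma> v j] \<sigma> v j slack unfolding cols_eq by metis
    define \<sigma>' where "\<sigma>' = T.join {v} (T.join U \<sigma> a) (\<lambda>_. j)"
    have nbrs: "finite (T.nbrs (pverts G) v)" using T.finV by (simp add: T.nbrs_def)
    then have finU: "finite U" using U finite_subset by blast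
    have "card U \<le> D" using card_mono[OF nbrs U] T.card_nbrs_le[OF v order.refl] by simp
    \<comment> \<open>The \<open>+ 1\<close> is \<open>v\<close> itself, besides at most
      \<open>D\<close> neighbours.\<close>
    then have "card (insert v U) \<le> D + 1" using finU by (simp add: card_insert_if)
    moreover have "hamming_dist G \<sigma> \<sigma>' \<le> card (insert v U)"
      using finU by (intro dist) (auto simp: \<sigma>'_def T.join_def)
    moreover have v': "\<sigma>' v = j" by (simp add: \<sigma>'_def T.join_def)
    ultimately have arc: "(\<sigma>, \<sigma>') \<in> parcs (colouring_graph G k (D + 1))"
      using \<sigma> cols' j by (auto simp: colouring_graph_def simp flip: \<sigma>'_def)
    have "\<sigma> \<rightarrow>\<^sup>*\<^bsub>with_proj (colouring_graph G k 1)\<^esub> T.join A \<sigma> a" if "A \<subseteq> U" for A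
      using finite_subset[OF that finU] that
    proof (induction A)
      case empty
      then show ?case using refl by (simp add: T.join_def)
    next
      case (insert x A)
      have "hamming_dist G (T.join A \<sigma> a) (T.join (insert x A) \<sigma> a) \<le> card {x}"
        by (intro dist) (auto simp: T.join_def)
      then have "hamming_dist G (T.join A \<sigma> a) (T.join (insert x A) \<sigma> a) \<le> 1" by simp
      moreover have "A \<subseteq> U" using insert.prems by simp
      ultimately show ?case
        by (intro reachable_colouring_graph_step[OF insert.IH cols cols[OF insert.prems]])
    qed
    note reach = this[OF order.refl]
    have "hamming_dist G (T.join U \<sigma> a) \<sigma>' \<le> card {v}"
      unfolding \<sigma>'_def T.join_def[of "{v}"] by (rule dist) simp_all
    then have "hamming_dist G (T.join U \<sigma> a) \<sigma>' \<le> 1" by simp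
    from reachable_colouring_graph_step[OF reach cols[OF order.refl] cols'[folded \<sigma>'_def] this]
    have "\<sigma> \<rightarrow>\<^sup>*\<^bsub>with_proj (colouring_graph G k 1)\<^esub> \<sigma>'" .
    then show ?thesis using arc v' by blast
  qed
  show "loose G k (D + 1) \<sigma> v"
    unfolding loose_def
  proof
    fix j assume "j \<in> {1..k}"
    then show "\<exists>\<sigma>'. (\<sigma>' = \<sigma> \<or> (\<sigma>, \<sigma>') \<in> parcs (colouring_graph G k (D + 1))) \<and> \<sigma>' v = j"
      using ex[of j] by (cases "\<sigma> v = j") auto
  qed
  show "thawed G k 1 \<sigma> v"
  proof (rule thawedI[OF \<sigma>])
    fix j assume "j \<in> {1..k}"
    then show "\<exists>\<sigma>'. \<sigma> \<rightarrow>\<^sup>*\<^bsub>with_proj (colouring_graph G k 1)\<^esub> \<sigma>' \<and> \<sigma>' v = j"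
      using ex[of j] refl by (cases "\<sigma> v = j") auto
  qed
qed

section \<open>Union bound over the neighbours and conclusion\<close>

lemma prob_loose_and_thawed_ge:
  fixes G :: "'v pair_pre_digraph"
  assumes G: "pair_graph G" "triangle_free G" and deg: "\<forall>u \<in> pverts G. out_degree (with_proj G) u \<le> D"
    and v: "v \<in> pverts G"
    and t: "0 < t" and s: "2 \<le> s" and m: "0 < m" "m \<le> real k - real t * real r"
    and p: "p = exp (real t * real D / (real s / 2)) / 2 ^ r
      + 2 ^ s * exp (- (m * exp (- (real D * (1 + 1 / real t) / m))) / 2)"
    and p_half: "p \<le> 1 / 2"
  shows "1 - real D * p \<le> measure_pmf.prob (pmf_of_set (proper_colourings G k))
    {\<sigma>. loose G k (D + 1) \<sigma> v \<and> thawed G k 1 \<sigma> v}"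
proof -
  interpret T: triangle_free_graph "pverts G" "parcs G" k D by (rule triangle_free_graphI[OF G deg])
  let ?V = "pverts G" and ?C = "proper_colourings G k"
  let ?good = "{\<sigma>. loose G k (D + 1) \<sigma> v \<and> thawed G k 1 \<sigma> v}"
  note cols_eq = T.cols_eq_proper_colourings[OF G(1) refl refl]
  have fin: "finite ?C" using T.finite_cols[OF T.finV] by (simp add: cols_eq)
  \<comment> \<open>Non-emptiness is what makes \<open>pmf_of_set\<close> the uniform
    distribution.\<close>
  have ne: "?C \<noteq> {}" using T.cols_nonempty[OF t s m p p_half] by (simp add: cols_eq)
  have frozen: "real (card {\<sigma> \<in> ?C. card (T.avail ?V \<sigma> u) < 2}) \<le> p * real (card ?C)" if "u \<in> ?V" for u
    using T.card_frozen_le[OF t s m p p_half that] by (simp add: cols_eq)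
  define N where "N = T.nbrs ?V v"
  have N: "finite N" "N \<subseteq> ?V" "card N \<le> D"
    using T.finV T.card_nbrs_le[OF v order.refl] by (auto simp: N_def T.nbrs_def)
  have p0: "0 \<le> p" unfolding p by simp
  \<comment> \<open>A colouring outside \<open>?good\<close> leaves some neighbour of
    \<open>v\<close> fewer than two colours; each of the at most \<open>D\<close> neighbours
    accounts for a proportion of at most \<open>p\<close>.\<close>
  have "?C - ?good \<subseteq> (\<Union>u\<in>N. {\<sigma> \<in> ?C. card (T.avail ?V \<sigma> u) < 2})"
    using loose_and_thawed_if_slack[OF G deg _ v] unfolding N_def by (force simp: not_less)
  then have "card (?C - ?good) \<le> card (\<Union>u\<in>N. {\<sigma> \<in> ?C. card (T.avail ?V \<sigma> u) < 2})"
    using fin N by (intro card_mono) auto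
  also have "\<dots> \<le> (\<Sum>u\<in>N. card {\<sigma> \<in> ?C. card (T.avail ?V \<sigma> u) < 2})"
    by (rule card_UN_le[OF N(1)])
  also have "real \<dots> \<le> (\<Sum>u\<in>N. p * real (card ?C))"
    unfolding of_nat_sum using frozen N by (intro sum_mono) auto
  also have "\<dots> \<le> real D * (p * real (card ?C))"
    using N p0 by (simp add: mult_right_mono)
  finally have bad: "real (card (?C - ?good)) \<le> real D * (p * real (card ?C))" by simp
  have pos: "0 < real (card ?C)" using fin ne by (simp add: card_gt_0_iff)
  have "card ?C = card (?C \<inter> ?good) + card (?C - ?good)"
    using fin by (subst card_Un_disjoint[symmetric]) (auto intro: arg_cong[where f = card])
  then have "(1 - real D * p) * real (card ?C) \<le> real (card (?C \<inter> ?good))"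
    using bad by (simp add: algebra_simps)
  then show ?thesis using pos by (simp add: measure_pmf_of_set[OF ne fin] pos_le_divide_eq)
qed

theorem theorem2p8:
  shows "\<forall>\<epsilon>::real. \<epsilon> > 0 \<longrightarrow> (\<exists>k\<^sub>0::nat. \<forall>k::nat. k \<ge> k\<^sub>0 \<longrightarrow>
    (\<forall>\<Delta>::nat. real \<Delta> \<le> (1 - \<epsilon>) * real k * ln (real k) \<longrightarrow>
      (\<forall>G :: 'v pair_pre_digraph.
         pair_graph G \<longrightarrow> triangle_free G \<longrightarrow>
         (\<forall>u \<in> pverts G. out_degree (with_proj G) u \<le> \<Delta>) \<longrightarrow>
         (\<forall>v \<in> pverts G.
            measure_pmf.prob (pmf_of_set (proper_colourings G k))
              {\<sigma>. loose G k (\<Delta> + 1) \<sigma> v \<and> thawed G k 1 \<sigma> v}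
            \<ge> 1 - exp (- (real \<Delta> powr (\<epsilon> / 3)))))))"
proof (intro allI impI)
  fix \<epsilon> :: real assume \<epsilon>: "\<epsilon> > 0"
  show "\<exists>k\<^sub>0::nat. \<forall>k::nat. k \<ge> k\<^sub>0 \<longrightarrow>
    (\<forall>\<Delta>::nat. real \<Delta> \<le> (1 - \<epsilon>) * real k * ln (real k) \<longrightarrow>
      (\<forall>G :: 'v pair_pre_digraph.
         pair_graph G \<longrightarrow> triangle_free G \<longrightarrow>
         (\<forall>u \<in> pverts G. out_degree (with_proj G) u \<le> \<Delta>) \<longrightarrow>
         (\<forall>v \<in> pverts G.
            measure_pmf.prob (pmf_of_set (proper_colourings G k))
              {\<sigma>. loose G k (\<Delta> + 1) \<sigma> v \<and> thawed G k 1 \<sigma> v}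
            \<ge> 1 - exp (- (real \<Delta> powr (\<epsilon> / 3))))))"
  proof (cases "\<epsilon> < 1")
    case True
    obtain k\<^sub>0 :: nat where k\<^sub>0: "\<forall>k\<ge>k\<^sub>0. \<forall>D::nat. real D \<le> (1 - \<epsilon>) * real k * ln (real k) \<longrightarrow>
      (\<exists>t s r :: nat. \<exists>m p :: real. 0 < t \<and> 2 \<le> s \<and> 0 < m \<and> m \<le> real k - real t * real r \<and>
        p = exp (real t * real D / (real s / 2)) / 2 ^ r
          + 2 ^ s * exp (- (m * exp (- (real D * (1 + 1 / real t) / m))) / 2) \<and>
        p \<le> 1 / 2 \<and> real D * p \<le> exp (- (real D powr (\<epsilon> / 3))))"
      using colouring_parameters_exist[OF \<epsilon> True] by blast
    show ?thesis
    proof (intro exI[of _ k\<^sub>0] allI impI ballI)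
      fix k \<Delta> :: nat and G :: "'v pair_pre_digraph" and v
      assume k: "k \<ge> k\<^sub>0" and \<Delta>: "real \<Delta> \<le> (1 - \<epsilon>) * real k * ln (real k)"
        and G: "pair_graph G" "triangle_free G" "\<forall>u \<in> pverts G. out_degree (with_proj G) u \<le> \<Delta>"
        and v: "v \<in> pverts G"
      obtain t s r :: nat and m p :: real where par: "0 < t" "2 \<le> s" "0 < m" "m \<le> real k - real t * real r"
        "p = exp (real t * real \<Delta> / (real s / 2)) / 2 ^ r
          + 2 ^ s * exp (- (m * exp (- (real \<Delta> * (1 + 1 / real t) / m))) / 2)"
        "p \<le> 1 / 2" "real \<Delta> * p \<le> exp (- (real \<Delta> powr (\<epsilon> / 3)))"
        using k\<^sub>0 k \<Delta> by blast
      show "1 - exp (- (real \<Delta> powr (\<epsilon> / 3))) \<le> measure_pmf.prob (pmf_of_set (proper_colourings G k))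
          {\<sigma>. loose G k (\<Delta> + 1) \<sigma> v \<and> thawed G k 1 \<sigma> v}"
        using prob_loose_and_thawed_ge[OF G v par(1-6)] par(7) by linarith
    qed
  next
    case False
    show ?thesis
    \<comment> \<open>\<open>k \<ge> 1\<close> makes \<open>ln k\<close> nonnegative, so
      \<open>\<epsilon> \<ge> 1\<close> forces \<open>\<Delta> = 0\<close>.\<close>
    proof (intro exI[of _ 1] allI impI ballI)
      fix k \<Delta> :: nat and G :: "'v pair_pre_digraph" and v
      assume "k \<ge> 1" "real \<Delta> \<le> (1 - \<epsilon>) * real k * ln (real k)"
      moreover from this have "(1 - \<epsilon>) * (real k * ln (real k)) \<le> 0"
        using False by (intro mult_nonpos_nonneg) auto
      ultimately have "\<Delta> = 0" by (simp add: mult.assoc)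
      \<comment> \<open>\<open>0 powr (\<epsilon> / 3) = 0\<close>, so the claimed lower bound is
        \<open>1 - exp 0 = 0\<close>.\<close>
      then show "1 - exp (- (real \<Delta> powr (\<epsilon> / 3))) \<le> measure_pmf.prob (pmf_of_set (proper_colourings G k))
          {\<sigma>. loose G k (\<Delta> + 1) \<sigma> v \<and> thawed G k 1 \<sigma> v}"
        by simp
    qed
  qed
qed

end
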